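(* Let $s\ne -n$, $r\neq -n$, $t\ne -n$ be real numbers. Let $K$ be a convex body in $\mathbb{R}^n$ with centroid at the origin and such that $\mu_K\{x\in\partial K:\kappa_K(x)=0\}=0$. (i) If $\frac{(n+r)(t-s)}{(n+t)(r-s)}>1$, then $$as_r(K)\le\big(as_t(K)\big)^{\frac{(r-s)(n+t)}{(t-s)(n+r)}}\big(as_s(K)\big)^{\frac{(t-r)(n+s)}{(t-s)(n+r)}}.$$ (ii) If $\frac{(n+r)t}{(n+t)r}>1$, then $$\left(\frac{as_r(K)}{n|K|}\right)\le\left(\frac{as_t(K)}{n|K|}\right)^{\frac{r(n+t)}{t(n+r)}}.$$
   Context: Here $n\ge 2$. A convex body is a compact convex subset of $\mathbb{R}^n$ with nonempty interior. $|\cdot|$ denotes volume and $\langle\cdot,\cdot\rangle$ the standard inner product. $N_K(x)$ is the outer unit normal to $\partial K$ at $x$, $\kappa_K(x)$ the (generalized) Gaussian curvature of $\partial K$ at $x$ (both exist for almost every $x\in\partial K$), and $\mu_K$ the usual surface area measure on $\partial K$. $L_p$ affine surface area: for real $p\neq -n$, $$as_p(K)=\int_{\partial K}\frac{\kappa_K(x)^{\frac{p}{n+p}}}{\langle x,N_K(x)\rangle^{\frac{n(p-1)}{n+p}}}\,d\mu_K(x),$$ where the integral of this nonnegative function may take the value $+\infty$. The conditions in (i) and (ii) are understood to include that the denominators are nonzero ($r\neq s$ in (i), $r\ne0$ in (ii)). *)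

theory Defs
  imports "HOL-Analysis.Analysis"
begin

definition convex_body :: "(real ^ 'n) set \<Rightarrow> bool" where
  "convex_body K \<longleftrightarrow> compact K \<and> convex K \<and> interior K \<noteq> {}"

definition centroid :: "(real ^ 'n) set \<Rightarrow> real ^ 'n" where
  "centroid K = (1 / measure lebesgue K) *\<^sub>R (LINT x:K|lebesgue. x)"

(* The k-dimensional Hausdorff measure (for k \<ge> 1), with the usual normalization which makes it
   agree with Lebesgue measure on k-dimensional subspaces.  Boundedness of the covering sets is
   required because diameter is a real-valued supremum, hence meaningless for unbounded sets. *)

definition hausdorff_covers :: "real \<Rightarrow> 'a::metric_space set \<Rightarrow> (nat \<Rightarrow> 'a set) set" where
  "hausdorff_covers d A = {C. A \<subseteq> (\<Union>i. C i) \<and> (\<forall>i. bounded (C i) \<and> diameter (C i) \<le> d)}"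

definition hausdorff_outer :: "nat \<Rightarrow> 'a::metric_space set \<Rightarrow> ennreal" where
  "hausdorff_outer k A = (SUP d\<in>{0<..}. INF C\<in>hausdorff_covers d A.
      \<Sum>i. ennreal (unit_ball_vol (real k) * (diameter (C i) / 2) ^ k))"

definition hausdorff_measure :: "nat \<Rightarrow> 'a::metric_space measure" where
  "hausdorff_measure k = measure_of UNIV (sets borel) (hausdorff_outer k)"

definition surface_measure :: "(real ^ 'n) set \<Rightarrow> (real ^ 'n) measure" where
  "surface_measure K = restrict_space (hausdorff_measure (CARD('n) - 1)) (frontier K)"

definition is_outer_unit_normal :: "(real ^ 'n) set \<Rightarrow> real ^ 'n \<Rightarrow> real ^ 'n \<Rightarrow> bool" where
  "is_outer_unit_normal K x u \<longleftrightarrow> norm u = 1 \<and> (\<forall>y\<in>K. (y - x) \<bullet> u \<le> 0)"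

(* Meaningful where the outer unit normal is unique, i.e. at almost every boundary point. *)
definition outer_normal :: "(real ^ 'n) set \<Rightarrow> real ^ 'n \<Rightarrow> real ^ 'n" where
  "outer_normal K x = (THE u. is_outer_unit_normal K x u)"

(* Near a boundary point x with unique outer unit normal u, the boundary of K is the graph of the
   convex function z \<mapsto> boundary_graph K x u z, defined for small z in the hyperplane orthogonal to u:
   the corresponding boundary point is x + z - boundary_graph K x u z *\<^sub>R u. *)
definition boundary_graph :: "(real ^ 'n) set \<Rightarrow> real ^ 'n \<Rightarrow> real ^ 'n \<Rightarrow> real ^ 'n \<Rightarrow> real" where
  "boundary_graph K x u z = Inf {h. x + z - h *\<^sub>R u \<in> K}"

(* Second-order differentiability in the generalized (Alexandrov) sense of the boundary at x.  The
   Hessian is a symmetric operator on the hyperplane orthogonal to u; it is represented by the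
   symmetric matrix H on the whole space that extends it by H u = u.  Thus H is unique and det H is
   the determinant of the Hessian, i.e. the product of the n - 1 generalized principal curvatures. *)
definition has_generalized_hessian ::
    "(real ^ 'n) set \<Rightarrow> real ^ 'n \<Rightarrow> real ^ 'n ^ 'n \<Rightarrow> bool" where
  "has_generalized_hessian K x H \<longleftrightarrow>
     (\<exists>!u. is_outer_unit_normal K x u) \<and>
     (let u = outer_normal K x in
        transpose H = H \<and> H *v u = u \<and>
        ((\<lambda>z. (boundary_graph K x u z - (z \<bullet> (H *v z)) / 2) / (norm z)\<^sup>2) \<longlongrightarrow> 0)
          (at 0 within {z. z \<bullet> u = 0}))"

(* By Alexandrov's theorem the generalized Hessian exists at almost every boundary point, so the
   value 0 chosen at the remaining points is immaterial. *)
definition gauss_curvature :: "(real ^ 'n) set \<Rightarrow> real ^ 'n \<Rightarrow> real" where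
  "gauss_curvature K x =
     (if \<exists>H. has_generalized_hessian K x H then det (THE H. has_generalized_hessian K x H) else 0)"

(* Real powers on [0, \<infinity>], with 0 and \<infinity> interchanged by negative exponents and with
   x ^ 0 = 1 for all x (whereas powr on the reals has 0 powr a = 0 for every a). *)
definition epowr :: "ennreal \<Rightarrow> real \<Rightarrow> ennreal" where
  "epowr x a =
     (if a = 0 then 1
      else if x = 0 then (if a > 0 then 0 else \<infinity>)
      else if x = \<infinity> then (if a > 0 then \<infinity> else 0)
      else ennreal (enn2real x powr a))"

(* L_p affine surface area, for p \<noteq> - n.  If the origin is an interior point of K, as it is when
   the centroid of K is the origin, then x \<bullet> outer_normal K x is positive. *)
definition affine_surface_area :: "real \<Rightarrow> (real ^ 'n) set \<Rightarrow> ennreal" where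
  "affine_surface_area p K = (let n = real CARD('n) in
     \<integral>\<^sup>+ x. epowr (ennreal (gauss_curvature K x)) (p / (n + p)) /
           epowr (ennreal (x \<bullet> outer_normal K x)) (n * (p - 1) / (n + p))
       \<partial>surface_measure K)"

end

theory Submission
  imports Defs
begin

text \<open>
  Write the integrand of the \<open>L\<^sub>p\<close> affine surface area as \<open>f\<^sub>p\<close>. Where curvature and support
  function are positive, hence almost everywhere, \<open>ln f\<^sub>p\<close> is an affine function of
  \<open>p / (n + p)\<close>, so \<open>f\<^sub>r = f\<^sub>t\<^sup>a * f\<^sub>s\<^sup>b\<close> with \<open>a + b = 1\<close>, and (i) is Hoelder's inequality. Since
  the lower integral of a non-measurable function need not satisfy Hoelder's inequality, the
  curvature has to be shown to be measurable: the Hessian is a limit of difference quotients of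
  boundary graphs.

  (ii) is the case \<open>s = 0\<close> of (i) together with \<open>as\<^sub>0(K) \<le> n |K|\<close>. For this inequality, map the
  volume of \<open>K\<close> to the boundary by radial projection. Near a point \<open>x\<close> with a unique normal \<open>u\<close>
  the image measure of a ball of radius \<open>\<rho>\<close> around \<open>x\<close> is asymptotically at least the volume
  \<open>(x \<bullet> u) \<omega> \<rho>\<^sup>n\<^sup>-\<^sup>1 / n\<close> of a cone over a flat disk, where \<open>\<omega>\<close> is the volume of the
  \<open>(n-1)\<close>-dimensional unit ball. A lower density bound for a finite measure bounds the Hausdorff
  measure from above by Vitali's covering lemma.
\<close>

subsection \<open>Hoelder's inequality in the extended nonnegative reals\<close>

lemma epowr_ennreal: "0 < x \<Longrightarrow> epowr (ennreal x) a = ennreal (x powr a)"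
  by (auto simp: epowr_def top_unique)

lemma epowr_mono: "0 \<le> a \<Longrightarrow> x \<le> y \<Longrightarrow> epowr x a \<le> epowr y a"
  by (cases x; cases y)
    (auto simp: epowr_def top_unique ennreal_eq_0_iff intro!: ennreal_leI powr_mono2)

lemma epowr_divide:
  assumes "0 \<le> a" "0 < v"
  shows "epowr (x / ennreal v) a = epowr x a / ennreal (v powr a)"
proof (cases x)
  case (real y)
  then show ?thesis
    using assms by (auto simp: epowr_def divide_ennreal powr_divide ennreal_eq_0_iff field_simps
        zero_less_divide_iff)
next
  case top
  then show ?thesis
    using assms by (auto simp: epowr_def ennreal_top_divide divide_ennreal)
qed

text \<open>Young's inequality is applied to the integrands divided by their integrals, multiplied
  back by \<open>c = A powr a * B powr b\<close> and integrated. The powers are \<open>epowr\<close>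
  because affine surface areas may be infinite.\<close>

lemma nn_integral_Hoelder_epowr:
  assumes [measurable]: "f \<in> borel_measurable M" "g \<in> borel_measurable M"
    and a: "0 < a" and b: "0 < b" and ab: "a + b = 1"
  shows "(\<integral>\<^sup>+x. epowr (f x) a * epowr (g x) b \<partial>M)
    \<le> epowr (\<integral>\<^sup>+x. f x \<partial>M) a * epowr (\<integral>\<^sup>+x. g x \<partial>M) b"
proof -
  let ?A = "\<integral>\<^sup>+x. f x \<partial>M" and ?B = "\<integral>\<^sup>+x. g x \<partial>M"
  \<comment> \<open>A vanishing integral takes precedence over an infinite one: the right side is
    then \<open>0 * top = 0\<close>, and the left integrand is zero almost everywhere.\<close>
  consider "?A = 0 \<or> ?B = 0" | "?A \<noteq> 0" "?B \<noteq> 0" "?A = top \<or> ?B = top"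
    | "?A \<noteq> 0" "?B \<noteq> 0" "?A \<noteq> top" "?B \<noteq> top" by blast
  then show ?thesis
  proof cases
    case 1
    then have "AE x in M. f x = 0 \<or> g x = 0"
      by (auto simp: nn_integral_0_iff_AE elim!: eventually_mono)
    then have "AE x in M. epowr (f x) a * epowr (g x) b = 0"
      by eventually_elim (use a b in \<open>auto simp: epowr_def\<close>)
    then have "(\<integral>\<^sup>+x. epowr (f x) a * epowr (g x) b \<partial>M) = (\<integral>\<^sup>+x. 0 \<partial>M)"
      by (rule nn_integral_cong_AE)
    then show ?thesis by simp
  next
    case 2
    then have "epowr ?A a * epowr ?B b = top"
      using a b by (cases ?A; cases ?B) (auto simp: epowr_def ennreal_mult_eq_top_iff ennreal_eq_0_iff)
    then show ?thesis by simp
  next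
    case 3
    then obtain A B where A: "?A = ennreal A" "0 < A" and B: "?B = ennreal B" "0 < B"
      by (metis ennreal_cases ennreal_0 less_eq_real_def)
    define c where "c = A powr a * B powr b"
    have c: "0 < c" using A B by (simp add: c_def)
    have "epowr (f x) a * epowr (g x) b \<le> ennreal (c * a / A) * f x + ennreal (c * b / B) * g x" for x
    proof (cases "f x = top \<or> g x = top")
      case True
      have "0 < c * a / A" "0 < c * b / B" using a b c A B by auto
      with True have "ennreal (c * a / A) * f x + ennreal (c * b / B) * g x = top"
        by (auto simp: ennreal_mult_eq_top_iff ennreal_eq_0_iff simp del: zero_less_divide_iff)
      then show ?thesis by (simp only: top_greatest)
    next
      case False
      then obtain y z where fg: "f x = ennreal y" "0 \<le> y" "g x = ennreal z" "0 \<le> z"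
        by (metis ennreal_cases)
      show ?thesis
      proof (cases "y = 0 \<or> z = 0")
        case True
        then show ?thesis using fg a b by (auto simp: epowr_def)
      next
        case False
        then have yz: "0 < y" "0 < z" using fg by auto
        have "(y / A) powr a * (z / B) powr b \<le> a * (y / A) + b * (z / B)"
          using yz A B a b ab by (intro Youngs_inequality_0) auto
        then have "c * ((y / A) powr a * (z / B) powr b) \<le> c * (a * (y / A) + b * (z / B))"
          using c by simp
        moreover have "c * ((y / A) powr a * (z / B) powr b) = y powr a * z powr b"
          using A B yz by (simp add: c_def powr_divide)
        ultimately have "y powr a * z powr b \<le> c * a / A * y + c * b / B * z"
          by (simp add: algebra_simps)
        then show ?thesis
          using fg yz a b c A B
          by (simp add: epowr_ennreal flip: ennreal_mult' ennreal_plus)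
      qed
    qed
    then have "(\<integral>\<^sup>+x. epowr (f x) a * epowr (g x) b \<partial>M)
      \<le> (\<integral>\<^sup>+x. ennreal (c * a / A) * f x + ennreal (c * b / B) * g x \<partial>M)"
      by (intro nn_integral_mono) auto
    also have "\<dots> = ennreal (c * a / A) * ennreal A + ennreal (c * b / B) * ennreal B"
      using A B by (simp add: nn_integral_add nn_integral_cmult)
    also have "\<dots> = ennreal (c * a + c * b)"
      using A B a b c by (simp flip: ennreal_mult' ennreal_plus)
    also have "c * a + c * b = c"
      using ab by (metis distrib_left mult.right_neutral)
    also have "ennreal c = epowr ?A a * epowr ?B b"
      using A B by (simp add: c_def epowr_ennreal ennreal_mult')
    finally show ?thesis .
  qed
qed

subsection \<open>Hausdorff measure and lower densities\<close>

text \<open>Vitali's covering lemma selects disjoint small balls whose total mass is at most that of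
  \<open>U\<close>. Keeping the first \<open>N\<close> balls as they are and enlarging only the
  others five times still covers \<open>A\<close>. The factor \<open>5 ^ k\<close> thus affects only
  a small tail of a convergent series and leaves the constant sharp.\<close>

lemma hausdorff_premeasure_le_of_density:
  fixes \<nu> :: "'a::euclidean_space measure"
  assumes sets: "sets \<nu> = sets borel" and fin: "finite_measure \<nu>"
    and k: "0 < k" and c: "0 < c" and d: "0 < d" and U: "open U" "A \<subseteq> U"
    and dens: "\<And>x. x \<in> A \<Longrightarrow>
      \<exists>\<rho>0>0. \<forall>\<rho>. 0 < \<rho> \<and> \<rho> < \<rho>0 \<longrightarrow> c * \<rho> ^ k \<le> measure \<nu> (cball x \<rho>)"
  shows "(INF C\<in>hausdorff_covers d A.
      \<Sum>i. ennreal (unit_ball_vol (real k) * (diameter (C i) / 2) ^ k))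
    \<le> ennreal (unit_ball_vol (real k) / c) * emeasure \<nu> U"
proof -
  interpret finite_measure \<nu> by (rule fin)
  have cb [measurable]: "cball x \<rho> \<in> sets \<nu>" for x \<rho> by (simp add: sets)
  have Um: "U \<in> sets \<nu>" using U by (simp add: sets)
  define w where "w = unit_ball_vol (real k)"
  have w: "0 < w" by (simp add: w_def)
  \<comment> \<open>The condition \<open>10 * \<rho> \<le> d\<close> leaves room for the diameter of
    the enlarged balls.\<close>
  define J where "J = {(x, \<rho>). x \<in> A \<and> 0 < \<rho> \<and> 10 * \<rho> \<le> d \<and> cball x \<rho> \<subseteq> U \<and>
    c * \<rho> ^ k \<le> measure \<nu> (cball x \<rho>)}"
  have fine: "\<exists>\<rho><e. (x, \<rho>) \<in> J" if x: "x \<in> A" and e: "0 < e" for x e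
  proof -
    obtain \<rho>0 where \<rho>0: "\<rho>0 > 0" "\<And>\<rho>. 0 < \<rho> \<Longrightarrow> \<rho> < \<rho>0 \<Longrightarrow> c * \<rho> ^ k \<le> measure \<nu> (cball x \<rho>)"
      using dens[OF x] by blast
    obtain \<rho>1 where \<rho>1: "\<rho>1 > 0" "cball x \<rho>1 \<subseteq> U"
      using U x open_contains_cball by blast
    define \<rho> where "\<rho> = min (min (e / 2) (\<rho>0 / 2)) (min \<rho>1 (d / 10))"
    have "cball x \<rho> \<subseteq> cball x \<rho>1" by (auto simp: \<rho>_def)
    moreover have "0 < \<rho>" "\<rho> < e" "\<rho> < \<rho>0" "10 * \<rho> \<le> d"
      using \<rho>0 \<rho>1 e d by (auto simp: \<rho>_def min_def)
    ultimately show ?thesis using x \<rho>0 \<rho>1 by (auto simp: J_def)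
  qed
  have J: "0 < snd i \<and> snd i \<le> d" if "i \<in> J" for i using that by (auto simp: J_def)
  obtain C where C: "countable C" "C \<subseteq> J"
      "pairwise (\<lambda>i j. disjnt (cball (fst i) (snd i)) (cball (fst j) (snd j))) C"
    and Ccov: "\<And>i. i \<in> J \<Longrightarrow> \<exists>j. j \<in> C \<and>
      \<not> disjnt (cball (fst i) (snd i)) (cball (fst j) (snd j)) \<and>
      cball (fst i) (snd i) \<subseteq> ball (fst j) (5 * snd j)"
    by (rule Vitali_covering_lemma_cballs_balls[OF J, where a = fst]) (blast intro: that)+
  \<comment> \<open>The family \<open>C\<close> may be finite, so it is numbered by a subset
    \<open>I\<close> of the naturals and padded with empty sets.\<close>
  define I where "I = to_nat_on C ` C"
  define q where "q = from_nat_into C"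
  have q: "q i \<in> C" "to_nat_on C (q i) = i" if "i \<in> I" for i
    using that C(1) by (auto simp: I_def q_def)
  have qJ: "q i \<in> J" if "i \<in> I" for i using q(1)[OF that] C(2) by auto
  define B where "B i = (if i \<in> I then cball (fst (q i)) (snd (q i)) else {})" for i
  define B5 where "B5 i = (if i \<in> I then cball (fst (q i)) (5 * snd (q i)) else {})" for i
  define v where "v i = (if i \<in> I then snd (q i) ^ k else 0)" for i
  have v0: "0 \<le> v i" for i using J[OF qJ] by (auto simp: v_def less_imp_le)
  have disj: "disjoint_family B"
    unfolding disjoint_family_on_def
  proof (intro ballI impI)
    fix i j :: nat assume "i \<noteq> j"
    show "B i \<inter> B j = {}"
    proof (cases "i \<in> I \<and> j \<in> I")
      case True
      then have "q i \<noteq> q j" using q(2) \<open>i \<noteq> j\<close> by metis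
      then have "disjnt (cball (fst (q i)) (snd (q i))) (cball (fst (q j)) (snd (q j)))"
        using C(3) q(1) True by (meson pairwiseD)
      then show ?thesis using True by (simp add: B_def disjnt_def)
    qed (auto simp: B_def)
  qed
  have BU: "B i \<subseteq> U" for i using qJ[of i] by (auto simp: B_def J_def split_beta)
  have Bm: "B i \<in> sets \<nu>" for i by (simp add: B_def)
  have cv: "c * v i \<le> measure \<nu> (B i)" for i
    using qJ by (auto simp: v_def B_def J_def split_beta)
  have ms: "(\<lambda>i. measure \<nu> (B i)) sums measure \<nu> (\<Union>i. B i)"
    using Bm disj by (intro finite_measure_UNION) auto
  have "summable (\<lambda>i. c * v i)"
    by (rule summable_comparison_test'[OF sums_summable[OF ms], of 0])
      (use cv v0 c in \<open>auto simp: abs_mult\<close>)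
  then have sv: "summable v" using c by (simp add: summable_cmult_iff)
  have "c * suminf v = (\<Sum>i. c * v i)" by (rule suminf_mult[OF sv, symmetric])
  also have "\<dots> \<le> measure \<nu> (\<Union>i. B i)"
    unfolding sums_unique[OF ms]
    by (intro suminf_le cv summable_mult sv sums_summable[OF ms])
  also have "\<dots> \<le> measure \<nu> U"
    by (intro finite_measure_mono Um UN_least BU)
  finally have svU: "suminf v \<le> measure \<nu> U / c" using c by (simp add: field_simps)
  show ?thesis (is "?L \<le> _")
  proof (rule ennreal_le_epsilon)
    fix e :: real assume e: "0 < e"
    have sv5: "summable (\<lambda>i. 5 ^ k * v (i + N))" for N
      by (intro summable_mult summable_ignore_initial_segment sv)
    from e w have "0 < e / (w * 5 ^ k)" by simp
    from suminf_exist_split[OF this sv] obtain N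
      where "\<forall>n\<ge>N. norm (\<Sum>i. v (i + n)) < e / (w * 5 ^ k)" by blast
    then have "(\<Sum>i. v (i + N)) < e / (w * 5 ^ k)" by force
    then have tail: "w * (5 ^ k * (\<Sum>i. v (i + N))) \<le> e" using w by (simp add: field_simps)
    define cov where "cov i = (if i < N then B i else B5 i)" for i
    define v' where "v' i = (if i < N then v i else 5 ^ k * v i)" for i
    \<comment> \<open>Outside \<open>I\<close> the sets are empty, with diameter 0, and
      \<open>0 ^ k = 0\<close> because \<open>0 < k\<close>.\<close>
    have diam: "(diameter (cov i) / 2) ^ k = v' i" for i
      using qJ[of i] k
      by (auto simp: cov_def B_def B5_def J_def split_beta v'_def v_def power_mult_distrib)
    have "A \<subseteq> (\<Union>i. cov i)"
    proof
      fix x assume x: "x \<in> A"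
      show "x \<in> (\<Union>i. cov i)"
      proof (cases "x \<in> (\<Union>i<N. B i)")
        case True
        then show ?thesis by (auto simp: cov_def)
      next
        case False
        \<comment> \<open>The union of finitely many closed balls is closed, so a small ball about
          \<open>x\<close> avoids the first \<open>N\<close> of them. The ball of \<open>C\<close>
          that it meets by the covering lemma therefore has index at least \<open>N\<close>.\<close>
        have "closed (\<Union>i<N. B i)" by (auto simp: B_def)
        then have "open (- (\<Union>i<N. B i))" by (rule open_Compl)
        then obtain e where e: "0 < e" "cball x e \<subseteq> - (\<Union>i<N. B i)"
          using False open_contains_cball by blast
        obtain \<rho> where \<rho>: "\<rho> < e" "(x, \<rho>) \<in> J" using fine[OF x e(1)] by blast
        obtain j where j: "j \<in> C" "\<not> disjnt (cball x \<rho>) (cball (fst j) (snd j))"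
          "cball x \<rho> \<subseteq> ball (fst j) (5 * snd j)"
          using Ccov[OF \<rho>(2)] by auto
        define i where "i = to_nat_on C j"
        have i: "i \<in> I" "q i = j" using j(1) C(1) by (auto simp: i_def I_def q_def)
        have "cball x \<rho> \<subseteq> cball x e" using \<rho> by auto
        then have "\<not> i < N" using j(2) e(2) i by (auto simp: disjnt_def B_def)
        moreover have "x \<in> cball x \<rho>" using J[OF \<rho>(2)] by simp
        then have "x \<in> ball (fst j) (5 * snd j)" using j(3) by blast
        then have "x \<in> B5 i" using i by (simp add: B5_def)
        ultimately show ?thesis by (auto simp: cov_def)
      qed
    qed
    moreover have "bounded (cov i) \<and> diameter (cov i) \<le> d" for i
      using qJ[of i] d by (auto simp: cov_def B_def B5_def J_def split_beta)
    ultimately have "cov \<in> hausdorff_covers d A" by (auto simp: hausdorff_covers_def)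
    then have "?L \<le> (\<Sum>i. ennreal (w * (diameter (cov i) / 2) ^ k))"
      unfolding w_def by (rule INF_lower)
    also have "\<dots> = (\<Sum>i. ennreal (w * v' i))"
      using diam by simp
    also have "(\<Sum>i. ennreal (w * v' i)) = ennreal (\<Sum>i. w * v' i)"
    proof (rule suminf_ennreal2)
      show "0 \<le> w * v' i" for i using w v0 by (simp add: v'_def)
      have "summable (\<lambda>i. v' (i + N))" using sv5[of N] by (simp add: v'_def)
      then show "summable (\<lambda>i. w * v' i)" by (simp add: summable_iff_shift summable_mult)
    qed
    also have "(\<Sum>i. w * v' i) = w * suminf v'"
    proof (rule suminf_mult)
      have "summable (\<lambda>i. v' (i + N))" using sv5[of N] by (simp add: v'_def)
      then show "summable v'" by (simp add: summable_iff_shift)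
    qed
    also have "suminf v' = (\<Sum>i. v' (i + N)) + (\<Sum>i<N. v' i)"
    proof (rule suminf_split_initial_segment)
      have "summable (\<lambda>i. v' (i + N))" using sv5[of N] by (simp add: v'_def)
      then show "summable v'" by (simp add: summable_iff_shift)
    qed
    also have "(\<Sum>i. v' (i + N)) = 5 ^ k * (\<Sum>i. v (i + N))"
      unfolding v'_def by (simp add: suminf_mult summable_ignore_initial_segment sv)
    also have "(\<Sum>i<N. v' i) = (\<Sum>i<N. v i)"
      by (intro sum.cong) (auto simp: v'_def)
    also have "w * (5 ^ k * (\<Sum>i. v (i + N)) + (\<Sum>i<N. v i)) \<le> e + w * (measure \<nu> U / c)"
    proof -
      have "(\<Sum>i<N. v i) \<le> suminf v" by (rule sum_le_suminf[OF sv]) (use v0 in auto)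
      then have "(\<Sum>i<N. v i) \<le> measure \<nu> U / c" using svU by linarith
      then have "w * (\<Sum>i<N. v i) \<le> w * (measure \<nu> U / c)" by (rule mult_left_mono) (use w in simp)
      then show ?thesis using tail by (simp add: distrib_left)
    qed
    finally have "?L \<le> ennreal (e + w * (measure \<nu> U / c))" by (simp add: ennreal_leI)
    also have "\<dots> = ennreal (w / c) * emeasure \<nu> U + ennreal e"
      using w c e by (simp add: emeasure_eq_measure add.commute flip: ennreal_mult'' ennreal_plus)
    finally show "?L \<le> ennreal (unit_ball_vol (real k) / c) * emeasure \<nu> U + ennreal e"
      by (simp add: w_def)
  qed
qed

text \<open>The preceding bound is uniform in \<open>d\<close>, so it passes to the supremum. Outer
  regularity of the finite Borel measure then shrinks \<open>U\<close> to \<open>A\<close>.\<close>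

lemma hausdorff_outer_le_of_density:
  fixes \<nu> :: "'a::euclidean_space measure"
  assumes sets: "sets \<nu> = sets borel" and fin: "finite_measure \<nu>"
    and k: "0 < k" and c: "0 < c" and A: "A \<in> sets borel"
    and dens: "\<And>x. x \<in> A \<Longrightarrow>
      \<exists>\<rho>0>0. \<forall>\<rho>. 0 < \<rho> \<and> \<rho> < \<rho>0 \<longrightarrow> c * \<rho> ^ k \<le> measure \<nu> (cball x \<rho>)"
  shows "hausdorff_outer k A \<le> ennreal (unit_ball_vol (real k) / c) * emeasure \<nu> A"
proof -
  interpret finite_measure \<nu> by (rule fin)
  let ?w = "ennreal (unit_ball_vol (real k) / c)"
  have w: "?w \<noteq> 0" "?w \<noteq> top" using c by (auto simp: ennreal_eq_0_iff not_le)
  \<comment> \<open>Dividing by the constant isolates \<open>emeasure \<nu> U\<close>, so that the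
    infimum over open \<open>U\<close> can be taken directly.\<close>
  have "hausdorff_outer k A / ?w \<le> emeasure \<nu> U" if "A \<subseteq> U" "open U" for U
  proof -
    have "hausdorff_outer k A \<le> ?w * emeasure \<nu> U"
      unfolding hausdorff_outer_def using that assms
      by (intro SUP_least hausdorff_premeasure_le_of_density) auto
    then show ?thesis using w by (simp add: divide_le_posI_ennreal zero_less_iff_neq_zero mult.commute)
  qed
  then have "hausdorff_outer k A / ?w \<le> emeasure \<nu> A"
    using emeasure_finite by (subst outer_regular[OF sets _ A]) (auto intro!: INF_greatest)
  then have "hausdorff_outer k A / ?w * ?w \<le> emeasure \<nu> A * ?w" by (rule mult_right_mono) simp
  moreover have "hausdorff_outer k A / ?w * ?w = hausdorff_outer k A"
    using w by (simp add: ennreal_divide_times less_top)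
  ultimately show ?thesis by (simp only: mult.commute)
qed

text \<open>Countable additivity of the Hausdorff outer measure is not needed here, because
  \<open>measure_of\<close> returns the zero measure when it fails.\<close>

lemma emeasure_hausdorff_measure_le: "emeasure (hausdorff_measure k) A \<le> hausdorff_outer k A"
  by (simp add: hausdorff_measure_def emeasure_measure_of_conv)

subsection \<open>The centroid\<close>

lemma measure_convex_body_pos: "convex_body K \<Longrightarrow> 0 < measure lebesgue K"
proof -
  assume "convex_body K"
  then have K: "compact K" "interior K \<noteq> {}" by (auto simp: convex_body_def)
  have "\<not> negligible (interior K)" using K(2) open_interior open_not_negligible by blast
  then have "\<not> negligible K" using interior_subset negligible_subset by blast
  then show ?thesis
    using lmeasurable_compact[OF K(1)]
    by (simp add: negligible_iff_measure0 zero_less_measure_iff)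
qed

text \<open>Otherwise a hyperplane through the origin has \<open>K\<close> on one side. Its linear
  functional has integral zero over \<open>K\<close> and is nonnegative there, so it vanishes almost
  everywhere on \<open>K\<close>, and the interior would lie in a hyperplane up to a null
  set.\<close>

lemma centroid_in_interior:
  fixes K :: "(real ^ 'n) set"
  assumes "convex_body K" "centroid K = 0"
  shows "0 \<in> interior K"
proof (rule ccontr)
  assume "0 \<notin> interior K"
  have K: "compact K" "convex K" "interior K \<noteq> {}" using assms(1) by (auto simp: convex_body_def)
  obtain a where a: "a \<noteq> 0" "\<And>x. x \<in> interior K \<Longrightarrow> 0 \<le> a \<bullet> x"
    using separating_hyperplane_set_0[OF convex_interior[OF K(2)] \<open>0 \<notin> interior K\<close>] by blast
  have "closure (interior K) \<subseteq> {x. 0 \<le> a \<bullet> x}"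
    by (intro closure_minimal closed_halfspace_ge) (use a(2) in auto)
  then have aK: "0 \<le> a \<bullet> x" if "x \<in> K" for x
    using that convex_closure_interior[OF K(2,3)] closure_subset[of K] by auto
  have int0: "(LINT x:K|lebesgue. x) = 0"
    using measure_convex_body_pos[OF assms(1)] assms(2) by (simp add: centroid_def)
  have "integrable lborel (\<lambda>x. indicator K x *\<^sub>R x)"
    by (rule borel_integrable_compact[OF K(1)]) (rule continuous_on_id)
  then have int: "integrable lebesgue (\<lambda>x. indicator K x *\<^sub>R x)"
    by (simp add: integrable_completion)
  have "(LINT x|lebesgue. a \<bullet> (indicator K x *\<^sub>R x)) = 0"
    using int int0 by (simp add: set_lebesgue_integral_def del: inner_scaleR_right)
  moreover have "0 \<le> a \<bullet> (indicator K x *\<^sub>R x)" for x using aK by (simp add: indicator_def)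
  ultimately have "AE x in lebesgue. a \<bullet> (indicator K x *\<^sub>R x) = 0"
    using int by (subst (asm) integral_nonneg_eq_0_iff_AE) (auto simp del: inner_scaleR_right)
  then have "AE x in lebesgue. x \<notin> interior K - {x. a \<bullet> x = 0}"
    by eventually_elim (use interior_subset in \<open>auto simp: indicator_def split: if_splits\<close>)
  then have "negligible (interior K - {x. a \<bullet> x = 0})"
    using completion.AE_iff_null_sets
    by (simp add: negligible_iff_null_sets AE_iff_null_sets flip: Compl_eq)
  then have "negligible (interior K)"
    using negligible_hyperplane[of a 0] a(1)
    by (metis Diff_partition Un_commute negligible_Un negligible_subset sup_ge2 Diff_subset_conv order_refl)
  then show False using K(3) open_interior open_not_negligible by blast
qed

subsection \<open>Smooth boundary points\<close>

lemma is_outer_unit_normal_outer_normal: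
  "\<exists>!u. is_outer_unit_normal K x u \<Longrightarrow> is_outer_unit_normal K x (outer_normal K x)"
  unfolding outer_normal_def by (rule theI')

text \<open>A small multiple \<open>e *\<^sub>R u\<close> lies in \<open>K\<close>, and there the
  supporting inequality reads \<open>e \<le> x \<bullet> u\<close>.\<close>

lemma inner_outer_normal_pos:
  assumes "0 \<in> interior K" "is_outer_unit_normal K x u"
  shows "0 < x \<bullet> u"
proof -
  obtain e where e: "0 < e" "cball 0 e \<subseteq> K"
    using assms(1) by (auto simp: mem_interior_cball)
  have u: "norm u = 1" "\<And>y. y \<in> K \<Longrightarrow> (y - x) \<bullet> u \<le> 0"
    using assms(2) by (auto simp: is_outer_unit_normal_def)
  have "e *\<^sub>R u \<in> K" using e u(1) by auto
  from u(2)[OF this] have "e * (u \<bullet> u) \<le> x \<bullet> u" by (simp add: inner_diff_left)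
  then show ?thesis using e(1) u(1) by (simp add: dot_square_norm)
qed

text \<open>The points \<open>p\<close> need not lie in \<open>K\<close>, so that the lemma also applies to hyperplanes
  separating \<open>K\<close> from a point outside.\<close>

lemma outer_unit_normals_near:
  assumes uniq: "\<And>v. is_outer_unit_normal K x v \<Longrightarrow> v = u" and e: "0 < e"
  obtains d where "0 < d"
    "\<And>p v. dist p x < d \<Longrightarrow> is_outer_unit_normal K p v \<Longrightarrow> dist v u < e"
proof (rule ccontr)
  assume "\<not> thesis"
  \<comment> \<open>Failure for every \<open>d\<close> gives points converging to \<open>x\<close>
    with normals that stay away from \<open>u\<close>. By compactness of the sphere a subsequence of
    the normals converges; its limit is a normal at \<open>x\<close>, hence
    \<open>u\<close>.\<close>
  then have "\<exists>p v. dist p x < inverse (real (Suc m)) \<and> is_outer_unit_normal K p v \<and> e \<le> dist v u"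
    for m
    using that[of "inverse (real (Suc m))"] by (force simp: not_less)
  then obtain p v where pv: "\<And>m. dist (p m) x < inverse (real (Suc m))"
      "\<And>m. is_outer_unit_normal K (p m) (v m)" "\<And>m. e \<le> dist (v m) u"
    by metis
  have "(\<lambda>m. dist (p m) x) \<longlonglongrightarrow> 0"
    using pv(1) by (intro tendsto_sandwich[OF _ _ tendsto_const LIMSEQ_inverse_real_of_nat])
      (auto simp: less_imp_le)
  then have p: "p \<longlonglongrightarrow> x" by (rule tendsto_dist_iff[THEN iffD2])
  have "v m \<in> sphere 0 1" for m using pv(2) by (simp add: is_outer_unit_normal_def)
  then obtain l s where l: "l \<in> sphere 0 1" and s: "strict_mono s" "(v \<circ> s) \<longlonglongrightarrow> l"
    using compact_sphere[of "0 :: real ^ 'a" 1] unfolding compact_def by metis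
  have ps: "(\<lambda>m. p (s m)) \<longlonglongrightarrow> x" using LIMSEQ_subseq_LIMSEQ[OF p s(1)] by (simp add: o_def)
  have vs: "(\<lambda>m. v (s m)) \<longlonglongrightarrow> l" using s(2) by (simp add: o_def)
  have "(y - x) \<bullet> l \<le> 0" if "y \<in> K" for y
  proof (rule tendsto_upperbound)
    show "(\<lambda>m. (y - p (s m)) \<bullet> v (s m)) \<longlonglongrightarrow> (y - x) \<bullet> l"
      by (intro tendsto_intros ps vs)
    show "\<forall>\<^sub>F m in sequentially. (y - p (s m)) \<bullet> v (s m) \<le> 0"
      using pv(2) that by (auto simp: is_outer_unit_normal_def)
  qed auto
  then have "l = u" using l by (intro uniq) (auto simp: is_outer_unit_normal_def)
  moreover have "e \<le> dist l u"
    by (rule tendsto_lowerbound[OF tendsto_dist[OF vs tendsto_const]]) (use pv(3) in auto)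
  ultimately show False using e by simp
qed

lemma continuous_on_outer_normal:
  assumes "\<And>x. x \<in> D \<Longrightarrow> \<exists>!u. is_outer_unit_normal K x u"
  shows "continuous_on D (outer_normal K)"
  unfolding continuous_on_iff
proof (intro ballI allI impI)
  fix x e assume x: "x \<in> D" and e: "0 < (e :: real)"
  have "v = outer_normal K x" if "is_outer_unit_normal K x v" for v
    using assms[OF x] is_outer_unit_normal_outer_normal that by blast
  then obtain d where "0 < d"
    "\<And>p v. dist p x < d \<Longrightarrow> is_outer_unit_normal K p v \<Longrightarrow> dist v (outer_normal K x) < e"
    using outer_unit_normals_near[OF _ e] by metis
  then show "\<exists>d>0. \<forall>x'\<in>D. dist x' x < d \<longrightarrow> dist (outer_normal K x') (outer_normal K x) < e"
    using assms is_outer_unit_normal_outer_normal by blast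
qed

text \<open>The tangent cone at a smooth point is a half-space. If \<open>x + q\<close> were outside
  \<open>K\<close>, a separating hyperplane moved to \<open>x + q\<close> would have a unit normal
  \<open>v\<close> near \<open>u\<close>, so
  \<open>q \<bullet> v \<le> q \<bullet> u + e * norm q \<le> 0\<close>; but
  \<open>x \<in> K\<close> forces \<open>0 < q \<bullet> v\<close>.\<close>

lemma smooth_point_tangent_cone:
  assumes K: "convex K" "closed K" and x: "x \<in> K"
    and uniq: "\<And>v. is_outer_unit_normal K x v \<Longrightarrow> v = u" and e: "0 < e"
  obtains d where "0 < d"
    "\<And>q. norm q < d \<Longrightarrow> q \<bullet> u \<le> - e * norm q \<Longrightarrow> x + q \<in> K"
proof -
  obtain d where d: "0 < d"
    "\<And>p v. dist p x < d \<Longrightarrow> is_outer_unit_normal K p v \<Longrightarrow> dist v u < e"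
    using outer_unit_normals_near[OF uniq e] by metis
  have "x + q \<in> K" if q: "norm q < d" "q \<bullet> u \<le> - e * norm q" for q
  proof (rule ccontr)
    assume "x + q \<notin> K"
    then obtain a b where ab: "a \<bullet> (x + q) < b" "\<And>y. y \<in> K \<Longrightarrow> b < a \<bullet> y"
      using separating_hyperplane_closed_point[OF K] by metis
    define v where "v = - (a /\<^sub>R norm a)"
    have a: "0 < norm a" using ab(1) ab(2)[OF x] by auto
    have "is_outer_unit_normal K (x + q) v"
      unfolding is_outer_unit_normal_def
    proof (intro conjI ballI)
      show "norm v = 1" using a by (simp add: v_def)
      fix y assume "y \<in> K"
      then have "a \<bullet> (x + q) \<le> a \<bullet> y" using ab by force
      then show "(y - (x + q)) \<bullet> v \<le> 0"
        using a by (simp add: v_def inner_diff_left inner_diff_right inner_commute[of _ a] divide_simps)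
    qed
    then have "dist v u < e" using d(2)[of "x + q" v] q(1) by (simp add: dist_norm)
    have "q \<bullet> (v - u) \<le> norm q * dist v u"
      by (simp add: dist_norm norm_cauchy_schwarz)
    also have "\<dots> \<le> norm q * e" using \<open>dist v u < e\<close> by (intro mult_left_mono) auto
    finally have "q \<bullet> v \<le> 0" using q(2) by (simp add: inner_diff_right algebra_simps)
    moreover have "a \<bullet> q < 0" using ab(1) ab(2)[OF x] by (simp add: inner_add_right)
    then have "0 < q \<bullet> v" using a by (simp add: v_def inner_commute[of q a] divide_simps)
    ultimately show False by simp
  qed
  with d(1) show thesis using that by blast
qed

subsection \<open>Curvature\<close>

text \<open>Projecting a closed set along a compact factor gives a closed set. This yields
  measurable sublevel sets for infima along lines, and so for boundary graphs.\<close>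

lemma closed_line_hits_below:
  fixes K :: "'a::euclidean_space set"
  assumes K: "compact K"
  shows "closed {(p, u). norm u = 1 \<and> (\<exists>h\<le>a. p - h *\<^sub>R u \<in> K)}"
proof -
  \<comment> \<open>The line is parametrized by its hit point \<open>k\<close> in the compact body
    instead of the unbounded \<open>h\<close>, which is recovered as
    \<open>(p - k) \<bullet> u\<close>.\<close>
  let ?T = "{(k, p, u). norm u = 1 \<and> p - k = ((p - k) \<bullet> u) *\<^sub>R u \<and> (p - k) \<bullet> u \<le> a}"
  have "closed ?T"
    unfolding split_beta
    by (intro closed_Collect_conj closed_Collect_eq closed_Collect_le continuous_intros)
  from closed_compact_projection[OF K this]
  have "closed {y. \<exists>k. k \<in> K \<and> (k, y) \<in> ?T}" by simp
  also have "{y. \<exists>k. k \<in> K \<and> (k, y) \<in> ?T} = {(p, u). norm u = 1 \<and> (\<exists>h\<le>a. p - h *\<^sub>R u \<in> K)}"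
    (is "?L = ?R")
  proof (intro set_eqI iffI)
    fix y assume "y \<in> ?L"
    then obtain k where k: "k \<in> K" "norm (snd y) = 1" "(fst y - k) \<bullet> snd y \<le> a"
      "fst y - k = ((fst y - k) \<bullet> snd y) *\<^sub>R snd y"
      by (auto simp: split_beta)
    from k(4) have "fst y - ((fst y - k) \<bullet> snd y) *\<^sub>R snd y = k" by (simp add: algebra_simps)
    with k show "y \<in> ?R" by (auto simp: split_beta)
  next
    fix y assume "y \<in> ?R"
    then obtain h where h: "norm (snd y) = 1" "h \<le> a" "fst y - h *\<^sub>R snd y \<in> K"
      by (auto simp: split_beta)
    moreover have "snd y \<bullet> snd y = 1" using h(1) by (simp add: dot_square_norm)
    ultimately show "y \<in> ?L" by (auto simp: split_beta intro!: exI[of _ "fst y - h *\<^sub>R snd y"])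
  qed
  finally show ?thesis .
qed

lemma borel_measurable_line_Inf:
  fixes K :: "'a::euclidean_space set"
  assumes K: "compact K"
    and pm [measurable]: "p \<in> borel_measurable M" and um [measurable]: "u \<in> borel_measurable M"
    and u1: "\<And>x. x \<in> space M \<Longrightarrow> norm (u x) = 1"
  shows "(\<lambda>x. Inf {h. p x - h *\<^sub>R u x \<in> K}) \<in> borel_measurable M"
proof (rule borel_measurableI_le)
  fix a
  let ?S = "\<lambda>x. {h. p x - h *\<^sub>R u x \<in> K}"
  let ?E = "\<lambda>a. {x \<in> space M. \<exists>h\<le>a. p x - h *\<^sub>R u x \<in> K}"
  have E [measurable]: "?E b \<in> sets M" for b
  proof -
    have "(\<lambda>x. (p x, u x)) -` {(p, u). norm u = 1 \<and> (\<exists>h\<le>b. p - h *\<^sub>R u \<in> K)} \<inter> space M \<in> sets M"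
      by (rule measurable_sets[OF _ borel_closed[OF closed_line_hits_below[OF K]]])
        measurable
    also have "(\<lambda>x. (p x, u x)) -` {(p, u). norm u = 1 \<and> (\<exists>h\<le>b. p - h *\<^sub>R u \<in> K)} \<inter> space M = ?E b"
      using u1 by auto
    finally show ?thesis .
  qed
  \<comment> \<open>A nonempty hit set is closed and bounded below, so its infimum is
    attained.\<close>
  have *: "Inf (?S x) \<le> a \<longleftrightarrow> (\<exists>h\<le>a. h \<in> ?S x)" if x: "x \<in> space M" and ne: "?S x \<noteq> {}" for x
  proof -
    have "closed ((\<lambda>h. p x - h *\<^sub>R u x) -` K)"
      by (intro closed_vimage compact_imp_closed K continuous_intros)
    then have cl: "closed (?S x)" by (simp add: vimage_def)
    obtain R where R: "\<And>k. k \<in> K \<Longrightarrow> norm k \<le> R"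
      using compact_imp_bounded[OF K] bounded_iff by blast
    have "- (norm (p x) + R) \<le> h" if "h \<in> ?S x" for h
    proof -
      have "norm (h *\<^sub>R u x) \<le> norm (p x) + norm (p x - h *\<^sub>R u x)"
        by (metis add_diff_cancel_left' diff_add_cancel norm_triangle_ineq4)
      then have "\<bar>h\<bar> \<le> norm (p x) + R" using R that u1[OF x] by force
      then show ?thesis by linarith
    qed
    then have bdd: "bdd_below (?S x)" by (rule bdd_belowI)
    show ?thesis
      using closed_contains_Inf[OF ne bdd cl] cInf_lower[OF _ bdd] by force
  qed
  \<comment> \<open>Where the line misses \<open>K\<close>, the infimum is the fixed real number
    \<open>Inf {}\<close>; these points form the complement of the union of the sets
    \<open>?E (real n)\<close>.\<close>
  have "{x \<in> space M. Inf (?S x) \<le> a} =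
    ?E a \<union> (if Inf {} \<le> a then space M - (\<Union>n::nat. ?E (real n)) else {})"
    (is "?L = ?R")
  proof (rule set_eqI)
    fix x
    have E_iff: "x \<in> (\<Union>n::nat. ?E (real n)) \<longleftrightarrow> x \<in> space M \<and> ?S x \<noteq> {}"
      by auto (meson real_arch_simple)
    show "x \<in> ?L \<longleftrightarrow> x \<in> ?R"
    proof (cases "?S x = {}")
      case True
      then have "x \<in> ?L \<longleftrightarrow> x \<in> space M \<and> Inf {} \<le> a" by (simp only: mem_Collect_eq)
      moreover have "x \<notin> ?E a" using True by blast
      ultimately show ?thesis using E_iff True by simp
    next
      case False
      then have "x \<in> ?L \<longleftrightarrow> x \<in> ?E a" using *[of x] by blast
      then show ?thesis using E_iff False by simp
    qed
  qed
  also have "\<dots> \<in> sets M"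
    by (intro sets.Un E) (auto intro!: sets.Diff sets.countable_UN E)
  finally show "{x \<in> space M. Inf (?S x) \<le> a} \<in> sets M" .
qed

section \<open>Boundary graphs and the quadratic form of the Hessian\<close>

lemma boundary_graph_nonneg:
  assumes K: "convex K" "closed K" and x: "x \<in> K"
    and u: "is_outer_unit_normal K x u" and uniq: "\<And>v. is_outer_unit_normal K x v \<Longrightarrow> v = u"
  shows "\<exists>d>0. \<forall>z. norm z < d \<and> z \<bullet> u = 0 \<longrightarrow> 0 \<le> boundary_graph K x u z"
proof -
  have uu: "norm u = 1" "u \<bullet> u = 1" using u by (auto simp: is_outer_unit_normal_def dot_square_norm)
  obtain d where d: "0 < d" "\<And>q. norm q < d \<Longrightarrow> q \<bullet> u \<le> - (1/2) * norm q \<Longrightarrow> x + q \<in> K"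
    using smooth_point_tangent_cone[OF K x uniq, of "1/2"] by auto
  have "0 \<le> boundary_graph K x u z" if z: "norm z < d / 2" "z \<bullet> u = 0" for z
    unfolding boundary_graph_def
  proof (rule cInf_greatest)
    \<comment> \<open>The point at depth \<open>norm z\<close> below \<open>x + z\<close> lies in
      \<open>K\<close> by the tangent cone lemma with \<open>e = 1/2\<close>, so the infimum is
      taken over a nonempty set.\<close>
    have "norm (z - norm z *\<^sub>R u) \<le> 2 * norm z"
      using norm_triangle_ineq4[of z "norm z *\<^sub>R u"] uu by simp
    then have "x + (z - norm z *\<^sub>R u) \<in> K"
      using z uu by (intro d(2)) (auto simp: inner_diff_left)
    then show "{h. x + z - h *\<^sub>R u \<in> K} \<noteq> {}" by (auto simp: algebra_simps)
    fix h assume "h \<in> {h. x + z - h *\<^sub>R u \<in> K}"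
    then have "(x + z - h *\<^sub>R u - x) \<bullet> u \<le> 0"
      using u unfolding is_outer_unit_normal_def by blast
    then show "0 \<le> h" using z(2) uu by (simp add: inner_diff_left inner_add_left)
  qed
  then show ?thesis using d(1) by (intro exI[of _ "d / 2"]) auto
qed

lemma boundary_graph_0:
  assumes "x \<in> K" "is_outer_unit_normal K x u"
  shows "boundary_graph K x u 0 = 0"
  unfolding boundary_graph_def
proof (rule cInf_eq_minimum)
  show "0 \<in> {h. x + 0 - h *\<^sub>R u \<in> K}" using assms by simp
  fix h assume "h \<in> {h. x + 0 - h *\<^sub>R u \<in> K}"
  then have "(x + 0 - h *\<^sub>R u - x) \<bullet> u \<le> 0"
    using assms unfolding is_outer_unit_normal_def by blast
  moreover have "u \<bullet> u = 1" using assms by (simp add: is_outer_unit_normal_def dot_square_norm)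
  ultimately show "0 \<le> h" by simp
qed

text \<open>Along \<open>z /\<^sub>R real (Suc k)\<close> the second-order expansion exhibits the
  quadratic form as the limit of a sequence, which preserves both sign and measurability.\<close>

lemma has_generalized_hessian_limit:
  assumes H: "has_generalized_hessian K x H" and x: "x \<in> K"
    and z: "z \<bullet> outer_normal K x = 0"
  shows "(\<lambda>k. 2 * (real (Suc k))\<^sup>2 * boundary_graph K x (outer_normal K x) (z /\<^sub>R real (Suc k)))
    \<longlonglongrightarrow> z \<bullet> (H *v z)"
proof (cases "z = 0")
  case True
  then show ?thesis
    using H x is_outer_unit_normal_outer_normal[of K x]
    by (simp add: boundary_graph_0 has_generalized_hessian_def)
next
  case False
  define u where "u = outer_normal K x"
  define y where "y k = z /\<^sub>R real (Suc k)" for k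
  let ?q = "\<lambda>z. (boundary_graph K x u z - (z \<bullet> (H *v z)) / 2) / (norm z)\<^sup>2"
  have "(\<lambda>k. inverse (real (Suc k)) *\<^sub>R z) \<longlonglongrightarrow> 0 *\<^sub>R z"
    by (intro tendsto_intros LIMSEQ_inverse_real_of_nat)
  then have "y \<longlonglongrightarrow> 0" by (simp add: y_def[abs_def])
  moreover have "y k \<noteq> 0" "y k \<bullet> u = 0" for k using False z by (auto simp: y_def u_def)
  ultimately have "filterlim y (at 0 within {z. z \<bullet> u = 0}) sequentially"
    by (auto simp: filterlim_at)
  moreover have "(?q \<longlongrightarrow> 0) (at 0 within {z. z \<bullet> u = 0})"
    using H by (simp add: has_generalized_hessian_def Let_def u_def)
  ultimately have "(\<lambda>k. ?q (y k)) \<longlonglongrightarrow> 0" by (rule filterlim_compose[rotated])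
  then have "(\<lambda>k. ?q (y k) * (2 * (norm z)\<^sup>2) + z \<bullet> (H *v z)) \<longlonglongrightarrow> 0 * (2 * (norm z)\<^sup>2) + z \<bullet> (H *v z)"
    by (intro tendsto_intros)
  moreover have "?q (y k) * (2 * (norm z)\<^sup>2) + z \<bullet> (H *v z)
    = 2 * (real (Suc k))\<^sup>2 * boundary_graph K x u (y k)" for k
  proof -
    define s where "s = real (Suc k)"
    have s: "s > 0" by (simp add: s_def)
    have yk: "y k \<bullet> (H *v y k) = (z \<bullet> (H *v z)) / s\<^sup>2" "(norm (y k))\<^sup>2 = (norm z)\<^sup>2 / s\<^sup>2"
      using s by (simp_all add: y_def s_def[symmetric] matrix_vector_mult_scaleR power2_eq_square field_simps del: of_nat_Suc)
    show ?thesis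
      unfolding s_def[symmetric] yk using s False by (simp add: field_simps)
  qed
  ultimately show ?thesis by (simp add: u_def y_def)
qed

text \<open>The quadratic form of the extended Hessian, expressed without choosing a matrix:
  \<open>H *v u = u\<close> contributes \<open>(w \<bullet> u)\<^sup>2\<close>, and the part of
  \<open>w\<close> orthogonal to \<open>u\<close> contributes the second-order limit.\<close>

definition curvature_form :: "(real ^ 'n) set \<Rightarrow> real ^ 'n \<Rightarrow> real ^ 'n \<Rightarrow> real" where
  "curvature_form K x w = (let u = outer_normal K x in
    (w \<bullet> u)\<^sup>2 + lim (\<lambda>k. 2 * (real (Suc k))\<^sup>2 *
      boundary_graph K x u ((w - (w \<bullet> u) *\<^sub>R u) /\<^sub>R real (Suc k))))"

lemma inner_matrix_vector_symmetric:
  fixes H :: "real ^ 'n ^ 'n"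
  shows "transpose H = H \<Longrightarrow> v \<bullet> (H *v w) = (H *v v) \<bullet> w"
  by (metis dot_lmul_matrix vector_transpose_matrix)

text \<open>As \<open>H\<close> is symmetric and fixes \<open>u\<close>, the cross terms between
  \<open>u\<close> and its orthogonal complement vanish. The first form serves uniqueness and
  measurability, the second one positivity.\<close>

lemma has_generalized_hessian_form:
  assumes H: "has_generalized_hessian K x H" and x: "x \<in> K"
  shows "w \<bullet> (H *v w) = curvature_form K x w"
    and "w \<bullet> (H *v w) = (w \<bullet> outer_normal K x)\<^sup>2 +
      (w - (w \<bullet> outer_normal K x) *\<^sub>R outer_normal K x) \<bullet>
      (H *v (w - (w \<bullet> outer_normal K x) *\<^sub>R outer_normal K x))"
proof -
  define u where "u = outer_normal K x"
  define z where "z = w - (w \<bullet> u) *\<^sub>R u"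
  have Hs: "transpose H = H" and Hu: "H *v u = u" and nu: "is_outer_unit_normal K x u"
    using H is_outer_unit_normal_outer_normal
    by (auto simp: has_generalized_hessian_def Let_def u_def)
  have uu: "u \<bullet> u = 1" using nu by (simp add: is_outer_unit_normal_def dot_square_norm)
  have zu: "z \<bullet> u = 0" using uu by (simp add: z_def inner_diff_left)
  have "w = z + (w \<bullet> u) *\<^sub>R u" by (simp add: z_def)
  then have "w \<bullet> (H *v w) = (z + (w \<bullet> u) *\<^sub>R u) \<bullet> (H *v (z + (w \<bullet> u) *\<^sub>R u))" by simp
  also have "\<dots> = z \<bullet> (H *v z) + (w \<bullet> u) * (u \<bullet> (H *v z)) + (w \<bullet> u)\<^sup>2"
    using zu uu Hu
    by (simp add: matrix_vector_right_distrib matrix_vector_mult_scaleR inner_add_left inner_add_right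
        power2_eq_square)
  also have "u \<bullet> (H *v z) = 0"
    using inner_matrix_vector_symmetric[OF Hs, of u z] Hu zu by (simp add: inner_commute[of u z])
  finally have *: "w \<bullet> (H *v w) = (w \<bullet> u)\<^sup>2 + z \<bullet> (H *v z)" by simp
  then show "w \<bullet> (H *v w) = (w \<bullet> outer_normal K x)\<^sup>2 +
      (w - (w \<bullet> outer_normal K x) *\<^sub>R outer_normal K x) \<bullet>
      (H *v (w - (w \<bullet> outer_normal K x) *\<^sub>R outer_normal K x))"
    by (simp add: u_def z_def)
  have "lim (\<lambda>k. 2 * (real (Suc k))\<^sup>2 * boundary_graph K x u (z /\<^sub>R real (Suc k))) = z \<bullet> (H *v z)"
    using has_generalized_hessian_limit[OF H x] zu by (intro limI) (simp add: u_def)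
  with * show "w \<bullet> (H *v w) = curvature_form K x w"
    by (simp add: curvature_form_def Let_def u_def z_def)
qed

lemma symmetric_matrix_polarization:
  fixes H :: "real ^ 'n ^ 'n"
  assumes "transpose H = H"
  defines "q \<equiv> \<lambda>w. w \<bullet> (H *v w)"
  shows "H $ i $ j = (q (axis i 1 + axis j 1) - q (axis i 1) - q (axis j 1)) / 2"
proof -
  have "axis i 1 \<bullet> (H *v axis j 1) = H $ i $ j"
    by (simp add: inner_axis' matrix_vector_mul_component column_def matrix_vector_mult_basis)
  moreover have "axis j 1 \<bullet> (H *v axis i 1) = axis i 1 \<bullet> (H *v axis j 1)"
    using inner_matrix_vector_symmetric[OF assms(1)] by (simp add: inner_commute)
  ultimately show ?thesis
    by (simp add: q_def matrix_vector_right_distrib inner_add_left inner_add_right)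
qed

text \<open>Polarization recovers each entry of a Hessian from \<open>curvature_form\<close>, which
  depends on \<open>K\<close> and \<open>x\<close> alone. Hence the Hessian is unique, which
  resolves the \<open>THE\<close> in \<open>gauss_curvature\<close>.\<close>

lemma gauss_curvature_eq_det_hessian:
  assumes H: "has_generalized_hessian K x H" and x: "x \<in> K"
  shows "gauss_curvature K x = det H"
    and "H = (\<chi> i j. (curvature_form K x (axis i 1 + axis j 1) - curvature_form K x (axis i 1)
      - curvature_form K x (axis j 1)) / 2)"
proof -
  have eq: "G = (\<chi> i j. (curvature_form K x (axis i 1 + axis j 1) - curvature_form K x (axis i 1)
      - curvature_form K x (axis j 1)) / 2)" if G: "has_generalized_hessian K x G" for G
  proof -
    have "transpose G = G" using G by (simp add: has_generalized_hessian_def Let_def)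
    from symmetric_matrix_polarization[OF this, unfolded has_generalized_hessian_form(1)[OF G x]]
    show ?thesis by (simp add: vec_eq_iff)
  qed
  from eq[OF H] show "H = (\<chi> i j. (curvature_form K x (axis i 1 + axis j 1) -
    curvature_form K x (axis i 1) - curvature_form K x (axis j 1)) / 2)" .
  have "(THE H. has_generalized_hessian K x H) = H"
    using H
  proof (rule the_equality)
    show "G = H" if "has_generalized_hessian K x G" for G
      by (rule trans[OF eq[OF that] eq[OF H, symmetric]])
  qed
  then show "gauss_curvature K x = det H" using H by (auto simp: gauss_curvature_def)
qed

text \<open>On the segment from \<open>H\<close> to the identity all matrices except possibly
  \<open>H\<close> are positive definite, hence invertible. By the intermediate value theorem the
  determinant cannot start out negative.\<close>

lemma det_pos_if_positive_semidefinite: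
  fixes H :: "real ^ 'n ^ 'n"
  assumes psd: "\<And>w. 0 \<le> w \<bullet> (H *v w)" and nz: "det H \<noteq> 0"
  shows "0 < det H"
proof (rule ccontr)
  assume "\<not> 0 < det H"
  define M where "M t = (1 - t) *\<^sub>R H + t *\<^sub>R mat 1" for t
  have "continuous_on {0..1} (\<lambda>t. det (M t))"
    unfolding det_def M_def by (intro continuous_intros)
  moreover have "det (M 0) \<le> 0" "0 \<le> det (M 1)" using \<open>\<not> 0 < det H\<close> by (auto simp: M_def)
  ultimately obtain t where t: "0 \<le> t" "t \<le> 1" "det (M t) = 0"
    using IVT'[of "\<lambda>t. det (M t)" 0 0 1] by auto
  have "t \<noteq> 0" using t(3) nz by (auto simp: M_def)
  then have "0 < t" using t(1) by simp
  have "w = 0" if "M t *v w = 0" for w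
  proof -
    have "0 = w \<bullet> (M t *v w)" using that by simp
    also have "\<dots> = (1 - t) * (w \<bullet> (H *v w)) + t * (w \<bullet> w)"
      by (simp add: M_def matrix_vector_mult_add_rdistrib inner_add_right
          scaleR_matrix_vector_assoc[symmetric])
    finally have "t * (w \<bullet> w) \<le> 0" using psd[of w] t(2) by (smt (verit) mult_nonneg_nonneg)
    then have "w \<bullet> w \<le> 0" using \<open>0 < t\<close> by (simp add: mult_le_0_iff)
    then show ?thesis by (meson inner_gt_zero_iff not_less)
  qed
  then have "invertible (M t)"
    using invertible_left_inverse matrix_left_invertible_ker by blast
  then show False using t(3) invertible_det_nz by blast
qed

text \<open>By convexity the boundary graph is nonnegative near 0, and so is its second-order limit.
  The Hessian is therefore positive semidefinite, and a nonzero determinant is positive.\<close>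

lemma gauss_curvature_pos:
  assumes K: "convex K" "closed K" and x: "x \<in> K" and nz: "gauss_curvature K x \<noteq> 0"
  shows "0 < gauss_curvature K x"
proof -
  define u where "u = outer_normal K x"
  obtain H where H: "has_generalized_hessian K x H"
    using nz by (auto simp: gauss_curvature_def split: if_splits)
  then have "\<exists>!u. is_outer_unit_normal K x u" by (simp add: has_generalized_hessian_def)
  then have u: "is_outer_unit_normal K x u" "\<And>v. is_outer_unit_normal K x v \<Longrightarrow> v = u"
    using is_outer_unit_normal_outer_normal u_def by blast+
  obtain d where d: "0 < d" "\<And>z. norm z < d \<Longrightarrow> z \<bullet> u = 0 \<Longrightarrow> 0 \<le> boundary_graph K x u z"
    using boundary_graph_nonneg[OF K x u] by blast
  have pos: "0 \<le> z \<bullet> (H *v z)" if z: "z \<bullet> u = 0" for z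
  proof (rule tendsto_lowerbound)
    show "(\<lambda>k. 2 * (real (Suc k))\<^sup>2 * boundary_graph K x u (z /\<^sub>R real (Suc k))) \<longlonglongrightarrow> z \<bullet> (H *v z)"
      using has_generalized_hessian_limit[OF H x] z by (simp add: u_def)
    have "(\<lambda>k. inverse (real (Suc k)) *\<^sub>R z) \<longlonglongrightarrow> 0 *\<^sub>R z"
      by (intro tendsto_intros LIMSEQ_inverse_real_of_nat)
    then have "\<forall>\<^sub>F k in sequentially. norm (z /\<^sub>R real (Suc k)) < d"
      using d(1) by (auto simp: tendsto_iff dist_norm)
    then show "\<forall>\<^sub>F k in sequentially.
        0 \<le> 2 * (real (Suc k))\<^sup>2 * boundary_graph K x u (z /\<^sub>R real (Suc k))"
      by eventually_elim (use z in \<open>auto intro!: mult_nonneg_nonneg d(2)\<close>)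
  qed auto
  have uu: "u \<bullet> u = 1" using u(1) by (simp add: is_outer_unit_normal_def dot_square_norm)
  have "0 \<le> w \<bullet> (H *v w)" for w
    unfolding has_generalized_hessian_form(2)[OF H x, of w] u_def[symmetric]
    by (intro add_nonneg_nonneg pos) (auto simp: inner_diff_left uu)
  then show ?thesis
    using det_pos_if_positive_semidefinite[of H] nz gauss_curvature_eq_det_hessian(1)[OF H x] by simp
qed

section \<open>Measurability of the normal and of the curvature\<close>

lemma borel_measurable_outer_normal:
  assumes "\<And>x. x \<in> D \<Longrightarrow> \<exists>!u. is_outer_unit_normal K x u"
  shows "outer_normal K \<in> borel_measurable (restrict_space borel D)"
  using assms by (intro borel_measurable_continuous_on_restrict continuous_on_outer_normal)

text \<open>The Hessian entries are combinations of \<open>curvature_form\<close> at fixed vectors,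
  which are limits of infima along lines, and the determinant is a polynomial in the
  entries.\<close>

lemma borel_measurable_gauss_curvature:
  assumes K: "compact K" and D: "D \<subseteq> K" "\<And>x. x \<in> D \<Longrightarrow> \<exists>H. has_generalized_hessian K x H"
  shows "gauss_curvature K \<in> borel_measurable (restrict_space borel D)"
proof -
  let ?M = "restrict_space borel D"
  have uniq: "\<exists>!u. is_outer_unit_normal K x u" if "x \<in> D" for x
    using D(2)[OF that] by (auto simp: has_generalized_hessian_def)
  have [measurable]: "outer_normal K \<in> borel_measurable ?M"
    using uniq by (rule borel_measurable_outer_normal)
  have [measurable]: "(\<lambda>x. x) \<in> borel_measurable ?M" by (intro measurable_restrict_space1) simp
  have [measurable]: "(\<lambda>x. curvature_form K x w) \<in> borel_measurable ?M" for w
  proof -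
    let ?z = "\<lambda>k x. (w - (w \<bullet> outer_normal K x) *\<^sub>R outer_normal K x) /\<^sub>R real (Suc k)"
    have [measurable]: "(\<lambda>x. boundary_graph K x (outer_normal K x) (?z k x)) \<in> borel_measurable ?M" for k
      unfolding boundary_graph_def
    proof (rule borel_measurable_line_Inf[OF K])
      show "norm (outer_normal K x) = 1" if "x \<in> space ?M" for x
        using is_outer_unit_normal_outer_normal[OF uniq, of x] that
        by (auto simp: is_outer_unit_normal_def space_restrict_space)
    qed measurable
    show ?thesis unfolding curvature_form_def Let_def by measurable
  qed
  have "gauss_curvature K x = det ((\<chi> i j. (curvature_form K x (axis i 1 + axis j 1) -
      curvature_form K x (axis i 1) - curvature_form K x (axis j 1)) / 2) :: real ^ 'a ^ 'a)"
    if xD: "x \<in> D" for x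
  proof -
    obtain H where H: "has_generalized_hessian K x H" using D(2)[OF xD] by blast
    have x: "x \<in> K" using D(1) xD by blast
    show ?thesis
      by (rule trans[OF gauss_curvature_eq_det_hessian(1)[OF H x]
            arg_cong[OF gauss_curvature_eq_det_hessian(2)[OF H x], of det]])
  qed
  moreover have "(\<lambda>x. det ((\<chi> i j. (curvature_form K x (axis i 1 + axis j 1) -
      curvature_form K x (axis i 1) - curvature_form K x (axis j 1)) / 2) :: real ^ 'a ^ 'a))
      \<in> borel_measurable ?M"
    unfolding det_def by simp
  ultimately show ?thesis
    by (subst measurable_cong) (auto simp: space_restrict_space)
qed

subsection \<open>Volumes of oblique cones\<close>

text \<open>The double integral of \<open>indicator A y * indicator B (x - y)\<close> is evaluated
  in both orders, with \<open>x - y\<close> substituted for \<open>y\<close> in between. The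
  cross-multiplied form avoids quotients of zero or infinite values.\<close>

lemma translation_invariant_measure_unique:
  fixes M :: "'a::euclidean_space measure"
  assumes sets: "sets M = sets borel" and "sigma_finite_measure M"
    and inv: "\<And>a. distr M borel ((+) a) = M"
    and A [measurable]: "A \<in> sets borel" and B [measurable]: "B \<in> sets borel"
  shows "emeasure M A * emeasure lborel B = emeasure lborel A * emeasure M B"
proof -
  interpret M: sigma_finite_measure M by fact
  interpret P: pair_sigma_finite M lborel
    by (rule pair_sigma_finite.intro) (rule assms, rule sigma_finite_lborel)
  have [measurable_cong]: "sets M = sets borel" by (rule sets)
  have shift: "(\<integral>\<^sup>+x. indicator C (x - y) \<partial>M) = emeasure M C"
    if [measurable]: "C \<in> sets borel" for C y
  proof -
    have "(\<integral>\<^sup>+x. indicator C (x - y) \<partial>distr M borel ((+) y)) = (\<integral>\<^sup>+x. indicator C x \<partial>M)"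
      by (subst nn_integral_distr) auto
    then show ?thesis by (simp add: inv sets)
  qed
  have flip: "(\<integral>\<^sup>+y. indicator A y * indicator B (x - y) \<partial>lborel) =
    (\<integral>\<^sup>+y. indicator A (x - y) * indicator B y \<partial>(lborel :: 'a measure))" for x
  proof -
    have "(lborel :: 'a measure) = distr lborel borel (\<lambda>y. x - y)"
      using lborel_affine[of "-1" x] by (simp add: density_1)
    then have "(\<integral>\<^sup>+y. indicator A y * indicator B (x - y) \<partial>lborel) =
      (\<integral>\<^sup>+y. indicator A y * indicator B (x - y) \<partial>distr lborel borel (\<lambda>y. x - y))"
      by simp
    also have "\<dots> = (\<integral>\<^sup>+y. indicator A (x - y) * indicator B y \<partial>lborel)"
      by (simp add: nn_integral_distr)
    finally show ?thesis .
  qed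
  have "emeasure lborel A * emeasure M B = (\<integral>\<^sup>+y. indicator A y * emeasure M B \<partial>lborel)"
    by (simp add: nn_integral_multc)
  also have "\<dots> = (\<integral>\<^sup>+y. \<integral>\<^sup>+x. indicator A y * indicator B (x - y) \<partial>M \<partial>lborel)"
    by (simp add: nn_integral_cmult shift)
  also have "\<dots> = (\<integral>\<^sup>+x. \<integral>\<^sup>+y. indicator A y * indicator B (x - y) \<partial>lborel \<partial>M)"
    by (rule P.Fubini') measurable
  also have "\<dots> = (\<integral>\<^sup>+x. \<integral>\<^sup>+y. indicator A (x - y) * indicator B y \<partial>lborel \<partial>M)"
    by (simp only: flip)
  also have "\<dots> = (\<integral>\<^sup>+y. \<integral>\<^sup>+x. indicator A (x - y) * indicator B y \<partial>M \<partial>lborel)"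
    by (rule P.Fubini'[symmetric]) measurable
  also have "\<dots> = (\<integral>\<^sup>+y. emeasure M A * indicator B y \<partial>lborel)"
    by (simp add: nn_integral_multc shift)
  also have "\<dots> = emeasure M A * emeasure lborel B"
    by (simp add: nn_integral_cmult)
  finally show ?thesis ..
qed

text \<open>The image of Lebesgue measure under \<open>f\<close> is translation invariant, because a
  shift by \<open>a\<close> after \<open>f\<close> is a shift by \<open>g a\<close> before it. So
  one factor governs the volumes of all preimages.\<close>

lemma emeasure_linear_vimage_cross:
  fixes f g :: "'a::euclidean_space \<Rightarrow> 'a"
  assumes f: "linear f" and g: "linear g" and fg: "\<And>x. f (g x) = x" "\<And>x. g (f x) = x"
    and A: "A \<in> sets borel" and B: "B \<in> sets borel"
  shows "emeasure lborel (f -` A) * emeasure lborel B = emeasure lborel A * emeasure lborel (f -` B)"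
proof -
  have [measurable]: "f \<in> borel_measurable borel"
    by (intro borel_measurable_continuous_onI linear_continuous_on linear_linear[THEN iffD2] f)
  define M where "M = distr lborel borel f"
  have M: "emeasure M C = emeasure lborel (f -` C)" if "C \<in> sets borel" for C
    using that by (simp add: M_def emeasure_distr)
  have "emeasure M A * emeasure lborel B = emeasure lborel A * emeasure M B"
  proof (rule translation_invariant_measure_unique[OF _ _ _ A B])
    show "sets M = sets borel" by (simp add: M_def)
    show "sigma_finite_measure M"
    proof
      have "emeasure M (cball 0 r) \<noteq> \<infinity>" for r
      proof -
        have "x \<in> g ` cball 0 r" if "f x \<in> cball 0 r" for x
          using imageI[OF that, of g] fg by simp
        then have "f -` cball 0 r = g ` cball 0 r" using fg by auto
        then have "bounded (f -` cball 0 r)"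
          using bounded_linear_image[OF bounded_cball linear_linear[THEN iffD2, OF g]] by simp
        then show ?thesis using emeasure_bounded_finite by (simp add: M less_top)
      qed
      then show "\<exists>A. countable A \<and> A \<subseteq> sets M \<and> \<Union> A = space M \<and> (\<forall>a\<in>A. emeasure M a \<noteq> \<infinity>)"
        by (intro exI[of _ "range (\<lambda>n. cball 0 (real n))"])
          (auto simp: M_def intro: real_arch_simple)
    qed
    fix a
    have "distr M borel ((+) a) = distr (distr lborel borel ((+) (g a))) borel f"
      by (simp add: M_def distr_distr o_def linear_add[OF f] fg)
    then show "distr M borel ((+) a) = M" by (simp add: M_def lborel_distr_plus)
  qed
  then show ?thesis by (simp add: M A B)
qed

lemma emeasure_lborel_cball_pos_finite:
  "emeasure lborel (cball (0 :: 'a::euclidean_space) 1) \<noteq> 0"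
  "emeasure lborel (cball (0 :: 'a::euclidean_space) 1) \<noteq> top"
  using less_imp_neq[OF unit_ball_vol_pos[of "real DIM('a)"]] by (auto simp: emeasure_cball)

text \<open>The volume factor is read off from the unit ball, which \<open>f\<close>
  preserves.\<close>

lemma emeasure_orthogonal_vimage:
  fixes f :: "'a::euclidean_space \<Rightarrow> 'a"
  assumes f: "orthogonal_transformation f" and A: "A \<in> sets borel"
  shows "emeasure lborel (f -` A) = emeasure lborel A"
proof -
  let ?B = "cball (0 :: 'a) 1"
  have bij: "bij f" using f by (rule orthogonal_transformation_bij)
  have "f -` ?B = ?B" using f by (auto simp: orthogonal_transformation)
  moreover have "emeasure lborel (f -` A) * emeasure lborel ?B =
      emeasure lborel A * emeasure lborel (f -` ?B)"
    using f bij
    by (intro emeasure_linear_vimage_cross[of f "inv f"] A orthogonal_transformation_linear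
        orthogonal_transformation_inv)
      (auto simp: bij_is_surj surj_f_inv_f bij_is_inj)
  ultimately show ?thesis
    using emeasure_lborel_cball_pos_finite[where 'a = 'a]
    by (simp add: mult.commute[of _ "emeasure lborel ?B"] ennreal_mult_cancel_left)
qed

text \<open>The volume factors of the shears along \<open>a\<close> and \<open>- a\<close> are reciprocal, and they are equal
  because a reflection conjugates the two shears.\<close>

lemma emeasure_shear_vimage:
  fixes u a :: "'a::euclidean_space"
  assumes u: "norm u = 1" and a: "a \<bullet> u = 0" and A: "A \<in> sets borel"
  shows "emeasure lborel ((\<lambda>y. y + (y \<bullet> u) *\<^sub>R a) -` A) = emeasure lborel A"
proof -
  define S where "S b y = y + (y \<bullet> u) *\<^sub>R b" for b y
  define \<rho> where "\<rho> y = y - (2 * (y \<bullet> u)) *\<^sub>R u" for y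
  let ?B = "cball (0 :: 'a) 1"
  have uu: "u \<bullet> u = 1" using u by (simp add: dot_square_norm)
  have S: "linear (S b)" for b
    by (rule linearI) (simp_all add: S_def inner_add_left algebra_simps)
  have SS: "S b (S (- b) y) = y" "S (- b) (S b y) = y" if "b \<bullet> u = 0" for b y
    using that by (simp_all add: S_def inner_add_left inner_diff_left)
  have \<rho>: "orthogonal_transformation \<rho>"
    unfolding orthogonal_transformation_def
  proof (intro conjI allI)
    show "linear \<rho>" by (rule linearI) (simp_all add: \<rho>_def inner_add_left algebra_simps)
    show "\<rho> v \<bullet> \<rho> w = v \<bullet> w" for v w
      by (simp add: \<rho>_def inner_diff_left inner_diff_right uu inner_commute[of u w])
  qed
  have S_meas: "S b -` C \<in> sets borel" if "C \<in> sets borel" for b C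
  proof -
    have "S b \<in> borel_measurable borel"
      by (intro borel_measurable_continuous_onI linear_continuous_on linear_linear[THEN iffD2] S)
    then show ?thesis using measurable_sets[of "S b" borel borel C] that by simp
  qed
  have cross: "emeasure lborel (S a -` C) * emeasure lborel ?B =
      emeasure lborel C * emeasure lborel (S a -` ?B)" if "C \<in> sets borel" for C
    using that a SS[of a] by (intro emeasure_linear_vimage_cross[of _ "S (- a)"] S) auto
  have "S (- a) -` ?B = \<rho> -` (S a -` ?B)"
  proof -
    have "\<rho> (S a (\<rho> y)) = S (- a) y" for y
      using a by (simp add: \<rho>_def S_def inner_add_left inner_diff_left uu algebra_simps)
    moreover have "norm (\<rho> z) = norm z" for z using \<rho> by (simp add: orthogonal_transformation)
    ultimately have "norm (S (- a) y) = norm (S a (\<rho> y))" for y by metis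
    then show ?thesis by auto
  qed
  then have neg: "emeasure lborel (S (- a) -` ?B) = emeasure lborel (S a -` ?B)"
    using emeasure_orthogonal_vimage[OF \<rho> S_meas[of ?B a]] by simp
  \<comment> \<open>With the preimage of \<open>?B\<close> under \<open>S (- a)\<close> as the set
    \<open>C\<close>, \<open>cross\<close> shows that the square of the volume factor is
    one.\<close>
  have "S a -` (S (- a) -` ?B) = ?B" using SS a by auto
  then have sq: "emeasure lborel ?B * emeasure lborel ?B =
      emeasure lborel (S a -` ?B) * emeasure lborel (S a -` ?B)"
    using cross[OF S_meas[of ?B "- a"]] neg by simp
  obtain \<beta> where \<beta>: "emeasure lborel ?B = ennreal \<beta>" "0 < \<beta>"
    using emeasure_lborel_cball_pos_finite[where 'a = 'a]
    by (metis ennreal_cases ennreal_0 less_eq_real_def)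
  obtain \<gamma> where \<gamma>: "emeasure lborel (S a -` ?B) = ennreal \<gamma>" "0 \<le> \<gamma>"
    using sq \<beta> by (cases "emeasure lborel (S a -` ?B)") (auto simp flip: ennreal_mult)
  have "\<beta> * \<beta> = \<gamma> * \<gamma>" using sq \<beta> \<gamma> by (simp flip: ennreal_mult)
  then have "\<beta> = \<gamma>" using \<beta>(2) \<gamma>(2) by (metis less_imp_le power2_eq_square power2_eq_imp_eq)
  then have "emeasure lborel (S a -` A) * ennreal \<beta> = emeasure lborel A * ennreal \<beta>"
    using cross[OF A] \<beta> \<gamma> by simp
  then have "emeasure lborel (S a -` A) = emeasure lborel A"
    using \<beta>(2) by (simp add: mult.commute[of _ "ennreal \<beta>"] ennreal_mult_cancel_left)
  then show ?thesis by (simp add: S_def[abs_def])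
qed

text \<open>Fubini in coordinates: the slice at height \<open>y\<close> is a ball of radius
  \<open>y * \<sigma>\<close> in one dimension less.\<close>

lemma emeasure_axis_cone:
  fixes b :: "'a::euclidean_space"
  assumes b: "b \<in> Basis" and \<sigma>: "0 < \<sigma>" and h: "0 < h"
  shows "emeasure lborel {y. 0 < y \<bullet> b \<and> y \<bullet> b \<le> h \<and> dist y ((y \<bullet> b) *\<^sub>R b) \<le> (y \<bullet> b) * \<sigma>}
    = ennreal (unit_ball_vol (real (DIM('a) - 1)) * \<sigma> ^ (DIM('a) - 1) * h ^ DIM('a) / DIM('a))"
proof -
  interpret product_sigma_finite "\<lambda>_. lborel" by standard
  define A where "A = Basis - {b}"
  have A: "finite A" "b \<notin> A" "Basis = insert b A" "card A = DIM('a) - 1"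
    using b by (auto simp: A_def)
  let ?k = "DIM('a) - 1"
  let ?w = "unit_ball_vol (real ?k)"
  let ?P = "Pi\<^sub>M A (\<lambda>_. lborel) :: ('a \<Rightarrow> real) measure"
  let ?C = "{y. 0 < y \<bullet> b \<and> y \<bullet> b \<le> h \<and> dist y ((y \<bullet> b) *\<^sub>R b) \<le> (y \<bullet> b) * \<sigma>}"
  let ?T = "\<lambda>f. \<Sum>i\<in>Basis. f i *\<^sub>R i :: 'a"
  let ?D = "{f. 0 < f b \<and> f b \<le> h \<and> sqrt (\<Sum>i\<in>A. (f i)\<^sup>2) \<le> f b * \<sigma>}"
  have TC: "?T f \<in> ?C \<longleftrightarrow> f \<in> ?D" for f :: "'a \<Rightarrow> real"
  proof -
    have "(\<Sum>i\<in>A. (dist (?T f \<bullet> i) ((?T f \<bullet> b) * (b \<bullet> i)))\<^sup>2) = (\<Sum>i\<in>A. (f i)\<^sup>2)"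
      using b by (intro sum.cong) (auto simp: A_def inner_not_same_Basis dist_real_def)
    moreover have "dist (?T f) ((?T f \<bullet> b) *\<^sub>R b) =
        sqrt (\<Sum>i\<in>insert b A. (dist (?T f \<bullet> i) ((?T f \<bullet> b) * (b \<bullet> i)))\<^sup>2)"
      unfolding A(3)[symmetric] by (subst euclidean_dist_l2) (simp add: L2_set_def)
    ultimately have "dist (?T f) ((?T f \<bullet> b) *\<^sub>R b) = sqrt (\<Sum>i\<in>A. (f i)\<^sup>2)"
      using A(1,2) b by (simp add: inner_same_Basis)
    then show ?thesis using b by simp
  qed
  have Cm: "?C \<in> sets borel" by measurable
  have Dm: "?D \<inter> space (Pi\<^sub>M (insert b A) (\<lambda>_. lborel)) \<in> sets (Pi\<^sub>M (insert b A) (\<lambda>_. lborel))"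
  proof -
    let ?M = "Pi\<^sub>M (insert b A) (\<lambda>_. lborel) :: ('a \<Rightarrow> real) measure"
    have "(\<lambda>f. f i) \<in> borel_measurable ?M" if "i \<in> insert b A" for i
      using measurable_component_singleton[OF that, of "\<lambda>_. lborel"] by simp
    then have m: "(\<lambda>f. \<Sum>i\<in>A. (f i)\<^sup>2) \<in> borel_measurable ?M"
      "(\<lambda>f. f b) \<in> borel_measurable ?M"
      by (auto intro!: borel_measurable_sum borel_measurable_power)
    have "{f \<in> space ?M. 0 < f b \<and> f b \<le> h \<and> sqrt (\<Sum>i\<in>A. (f i)\<^sup>2) \<le> f b * \<sigma>} \<in> sets ?M"
      by (intro sets.sets_Collect_conj borel_measurable_le borel_measurable_less
          borel_measurable_times measurable_compose[OF m(1) borel_measurable_sqrt]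
          borel_measurable_const m)
    also have "{f \<in> space ?M. 0 < f b \<and> f b \<le> h \<and> sqrt (\<Sum>i\<in>A. (f i)\<^sup>2) \<le> f b * \<sigma>} =
        ?D \<inter> space ?M" by auto
    finally show ?thesis .
  qed
  have "emeasure lborel ?C =
      emeasure (Pi\<^sub>M Basis (\<lambda>_. lborel)) (?T -` ?C \<inter> space (Pi\<^sub>M Basis (\<lambda>_. lborel)))"
    by (subst lborel_eq) (simp add: emeasure_distr Cm)
  also have "?T -` ?C = ?D" using TC by auto
  also have "emeasure (Pi\<^sub>M Basis (\<lambda>_. lborel)) (?D \<inter> space (Pi\<^sub>M Basis (\<lambda>_. lborel))) =
      (\<integral>\<^sup>+f. indicator (?D \<inter> space (Pi\<^sub>M (insert b A) (\<lambda>_. lborel))) f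
        \<partial>Pi\<^sub>M (insert b A) (\<lambda>_. lborel))"
    unfolding A(3) using Dm by simp
  also have "\<dots> = (\<integral>\<^sup>+y. \<integral>\<^sup>+f. indicator (?D \<inter> space (Pi\<^sub>M (insert b A) (\<lambda>_. lborel))) (f(b := y))
      \<partial>?P \<partial>lborel)"
    using A(1,2) Dm by (intro product_nn_integral_insert_rev) auto
  also have "\<dots> = (\<integral>\<^sup>+y. indicator {0<..h} y *
      emeasure ?P ({f. sqrt (\<Sum>i\<in>A. (f i)\<^sup>2) \<le> y * \<sigma>} \<inter> space ?P) \<partial>lborel)"
  proof (rule nn_integral_cong)
    fix y :: real
    have "(\<Sum>i\<in>A. ((f(b := y)) i)\<^sup>2) = (\<Sum>i\<in>A. (f i)\<^sup>2)" for f
      using A(2) by (intro sum.cong) auto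
    then have "(\<integral>\<^sup>+f. indicator (?D \<inter> space (Pi\<^sub>M (insert b A) (\<lambda>_. lborel))) (f(b := y)) \<partial>?P) =
      (\<integral>\<^sup>+f. indicator {0<..h} y *
        indicator ({f. sqrt (\<Sum>i\<in>A. (f i)\<^sup>2) \<le> y * \<sigma>} \<inter> space ?P) f \<partial>?P)"
      by (intro nn_integral_cong) (auto simp: indicator_def space_PiM PiE_def extensional_def)
    then show "(\<integral>\<^sup>+f. indicator (?D \<inter> space (Pi\<^sub>M (insert b A) (\<lambda>_. lborel))) (f(b := y)) \<partial>?P) =
      indicator {0<..h} y * emeasure ?P ({f. sqrt (\<Sum>i\<in>A. (f i)\<^sup>2) \<le> y * \<sigma>} \<inter> space ?P)"
      by (simp add: nn_integral_cmult)
  qed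
  also have "\<dots> = (\<integral>\<^sup>+y. ennreal (?w * \<sigma> ^ ?k * y ^ ?k) * indicator {0..h} y \<partial>lborel)"
  proof (rule nn_integral_cong_AE)
    \<comment> \<open>At \<open>y = 0\<close> the two integrands differ in dimension one, where
      \<open>0 ^ 0 = 1\<close>.\<close>
    have "AE y in lborel. y \<noteq> (0 :: real)" by (rule AE_lborel_singleton)
    then show "AE y in lborel. indicator {0<..h} y *
      emeasure ?P ({f. sqrt (\<Sum>i\<in>A. (f i)\<^sup>2) \<le> y * \<sigma>} \<inter> space ?P) =
      ennreal (?w * \<sigma> ^ ?k * y ^ ?k) * indicator {0..h} y"
    proof eventually_elim
      case (elim y)
      show ?case
      proof (cases "0 < y \<and> y \<le> h")
        case True
        then show ?thesis using emeasure_cball_aux[OF A(1), of "y * \<sigma>"] \<sigma> A(4)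
          by (simp add: power_mult_distrib mult_ac)
      qed (use elim in \<open>auto simp: indicator_def\<close>)
    qed
  qed
  also have "\<dots> = ennreal (?w * \<sigma> ^ ?k * h ^ Suc ?k / real (Suc ?k) -
      ?w * \<sigma> ^ ?k * 0 ^ Suc ?k / real (Suc ?k))"
  proof (rule nn_integral_FTC_Icc)
    have deriv: "((\<lambda>y. c * y ^ Suc k / real (Suc k)) has_real_derivative c * y ^ k) (at y)"
      for c y :: real and k
    proof -
      have "((\<lambda>y. c * y ^ Suc k / real (Suc k)) has_real_derivative
          c * (real (Suc k) * y ^ k) / real (Suc k)) (at y)"
        using DERIV_pow[of "Suc k" y UNIV] by (intro DERIV_cdivide DERIV_cmult) (simp del: of_nat_Suc)
      then show ?thesis by (simp del: of_nat_Suc)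
    qed
    show "((\<lambda>y. ?w * \<sigma> ^ ?k * y ^ Suc ?k / real (Suc ?k)) has_real_derivative
        ?w * \<sigma> ^ ?k * y ^ ?k) (at y)" for y
      by (rule deriv)
  qed (use \<sigma> h in auto)
  also have "Suc ?k = DIM('a)" by simp
  finally show ?thesis by (simp add: zero_power)
qed

text \<open>Up to its apex 0, the set is the cone over the disk of radius \<open>\<rho>\<close>
  about \<open>x\<close> orthogonal to \<open>u\<close>, scaled by \<open>\<theta>\<close>. A shear
  turns its axis into the direction of \<open>u\<close>, and an orthogonal map relates
  \<open>u\<close> to a coordinate axis; neither changes volumes.\<close>

lemma emeasure_oblique_cone:
  fixes x u :: "real ^ 'n"
  assumes u: "norm u = 1" and xu: "0 < x \<bullet> u" and \<theta>: "0 < \<theta>" and \<rho>: "0 < \<rho>"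
  shows "emeasure lborel {y. 0 < y \<bullet> u \<and> y \<bullet> u \<le> \<theta> * (x \<bullet> u) \<and>
      dist y ((y \<bullet> u / (x \<bullet> u)) *\<^sub>R x) \<le> (y \<bullet> u / (x \<bullet> u)) * \<rho>}
    = ennreal (unit_ball_vol (real (CARD('n) - 1)) * \<rho> ^ (CARD('n) - 1) * (x \<bullet> u) *
        \<theta> ^ CARD('n) / CARD('n))"
proof -
  obtain i :: 'n where True by simp
  let ?b = "axis i 1 :: real ^ 'n"
  let ?h = "x \<bullet> u"
  have b: "?b \<in> Basis" by (simp add: axis_in_Basis_iff)
  obtain T where T: "orthogonal_transformation T" "T ?b = u"
    using orthogonal_transformation_exists[of ?b u] u by auto
  \<comment> \<open>With this \<open>a\<close> the shear maps \<open>u\<close> to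
    \<open>x /\<^sub>R ?h\<close>.\<close>
  define a where "a = x /\<^sub>R ?h - u"
  have uu: "u \<bullet> u = 1" using u by (simp add: dot_square_norm)
  have a: "a \<bullet> u = 0" using xu uu by (simp add: a_def inner_diff_left)
  let ?Q = "{y. 0 < y \<bullet> u \<and> y \<bullet> u \<le> \<theta> * ?h \<and>
      dist y ((y \<bullet> u / ?h) *\<^sub>R x) \<le> (y \<bullet> u / ?h) * \<rho>}"
  let ?R = "{y. 0 < y \<bullet> u \<and> y \<bullet> u \<le> \<theta> * ?h \<and> dist y ((y \<bullet> u) *\<^sub>R u) \<le> (y \<bullet> u) * (\<rho> / ?h)}"
  let ?C = "{y. 0 < y \<bullet> ?b \<and> y \<bullet> ?b \<le> \<theta> * ?h \<and> dist y ((y \<bullet> ?b) *\<^sub>R ?b) \<le> (y \<bullet> ?b) * (\<rho> / ?h)}"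
  have m: "?Q \<in> sets borel" "?R \<in> sets borel" by measurable
  have "(\<lambda>y. y + (y \<bullet> u) *\<^sub>R a) -` ?Q = ?R"
  proof -
    have "(y + (y \<bullet> u) *\<^sub>R a) \<bullet> u = y \<bullet> u" for y using a by (simp add: inner_add_left)
    moreover have "dist (y + (y \<bullet> u) *\<^sub>R a) ((y \<bullet> u / ?h) *\<^sub>R x) = dist y ((y \<bullet> u) *\<^sub>R u)" for y
      by (simp add: dist_norm a_def algebra_simps divide_inverse)
    ultimately show ?thesis by auto
  qed
  then have QR: "emeasure lborel ?Q = emeasure lborel ?R"
    using emeasure_shear_vimage[OF u a m(1)] by simp
  have "T -` ?R = ?C"
  proof -
    have Tu: "T y \<bullet> u = y \<bullet> ?b" for y
      using T by (metis orthogonal_transformation_def)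
    have "dist (T y) (c *\<^sub>R u) = dist y (c *\<^sub>R ?b)" for y c
    proof -
      have "T (c *\<^sub>R ?b) = c *\<^sub>R u"
        using T(2) linear_scale[OF orthogonal_transformation_linear[OF T(1)]] by simp
      moreover have "dist (T y) (T z) = dist y z" for z
        using T(1) by (simp add: orthogonal_transformation_isometry)
      ultimately show ?thesis by metis
    qed
    then show ?thesis using Tu by auto
  qed
  then have "emeasure lborel ?R = emeasure lborel ?C"
    using emeasure_orthogonal_vimage[OF T(1) m(2)] by simp
  also have "\<dots> = ennreal (unit_ball_vol (real (DIM(real ^ 'n) - 1)) * (\<rho> / ?h) ^ (DIM(real ^ 'n) - 1) *
      (\<theta> * ?h) ^ DIM(real ^ 'n) / DIM(real ^ 'n))"
    using xu \<theta> \<rho> by (intro emeasure_axis_cone[OF b]) auto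
  also have "unit_ball_vol (real (DIM(real ^ 'n) - 1)) * (\<rho> / ?h) ^ (DIM(real ^ 'n) - 1) *
      (\<theta> * ?h) ^ DIM(real ^ 'n) = unit_ball_vol (real (DIM(real ^ 'n) - 1)) *
      ((\<rho> / ?h) ^ (DIM(real ^ 'n) - 1) * (\<theta> * ?h) ^ DIM(real ^ 'n))"
    by (rule mult.assoc)
  also have "(\<rho> / ?h) ^ (DIM(real ^ 'n) - 1) * (\<theta> * ?h) ^ DIM(real ^ 'n) =
      \<rho> ^ (CARD('n) - 1) * ?h * \<theta> ^ CARD('n)"
  proof -
    have "?h ^ CARD('n) = ?h * ?h ^ (CARD('n) - 1)" by (simp flip: power_Suc)
    then show ?thesis using xu by (simp only: power_divide power_mult_distrib) simp
  qed
  finally show ?thesis using QR by (simp add: mult.assoc)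
qed

subsection \<open>Radial projection\<close>

text \<open>For a body with the origin in its interior and \<open>y \<noteq> 0\<close> this is the
  boundary point on the ray through \<open>y\<close>, since \<open>sgn\<close> is injective on the
  frontier. Being built from the inverse of a continuous injection on a compact set, it is
  continuous away from 0.\<close>

definition radial_projection :: "'a::euclidean_space set \<Rightarrow> 'a \<Rightarrow> 'a" where
  "radial_projection K y = inv_into (frontier K) sgn (sgn y)"

context
  fixes K :: "'a::euclidean_space set"
  assumes compact: "compact K" and convex: "convex K" and zero: "0 \<in> interior K"
begin

lemma scaleR_mem_interior:
  assumes "x \<in> K" "0 \<le> s" "s < 1"
  shows "s *\<^sub>R x \<in> interior K"
  using mem_interior_convex_shrink[OF convex zero assms(1), of "1 - s"] assms(2,3)
  by (cases "s = 0") (auto simp: algebra_simps zero)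

lemma frontier_subset_body: "frontier K \<subseteq> K"
  using compact compact_imp_closed frontier_subset_closed by blast

lemma frontier_nonzero: "x \<in> frontier K \<Longrightarrow> x \<noteq> 0"
  using zero by (auto simp: frontier_def)

lemma frontier_ray_unique:
  assumes "x \<in> frontier K" "s *\<^sub>R x \<in> frontier K" "0 < s"
  shows "s = 1"
proof (rule ccontr)
  assume "s \<noteq> 1"
  then consider "s < 1" | "1 < s" by linarith
  then show False
  proof cases
    case 1
    then show False
      using scaleR_mem_interior[of x s] assms frontier_subset_body by (auto simp: frontier_def)
  next
    case 2
    then have "inverse s *\<^sub>R (s *\<^sub>R x) \<in> interior K"
      using assms frontier_subset_body by (intro scaleR_mem_interior) (auto simp: field_simps)
    then show False using assms by (simp add: frontier_def)
  qed
qed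

lemma inj_on_sgn_frontier: "inj_on sgn (frontier K)"
proof (rule inj_onI)
  fix x y assume xy: "x \<in> frontier K" "y \<in> frontier K" "sgn x = sgn y"
  have nz: "norm x > 0" "norm y > 0" using xy frontier_nonzero by auto
  have "y = norm y *\<^sub>R sgn x" using xy(3) nz by (simp add: sgn_div_norm)
  then have y: "y = (norm y / norm x) *\<^sub>R x" by (simp add: sgn_div_norm divide_inverse)
  then have "norm y / norm x = 1" using xy nz by (intro frontier_ray_unique[of x]) auto
  with y show "x = y" by simp
qed

lemma radial_projection_eqI:
  assumes "x \<in> frontier K" "x = s *\<^sub>R y" "0 < s"
  shows "radial_projection K y = x"
proof -
  have "sgn y = sgn x" using assms by (simp add: sgn_scaleR)
  then show ?thesis
    using inv_into_f_f[OF inj_on_sgn_frontier assms(1)] by (simp add: radial_projection_def)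
qed

lemma radial_projection_ray:
  assumes "y \<noteq> 0"
  obtains s where "0 < s" "radial_projection K y = s *\<^sub>R y" "s *\<^sub>R y \<in> frontier K"
proof -
  obtain d where d: "0 < d" "0 + d *\<^sub>R y \<in> frontier K"
    using ray_to_frontier[OF compact_imp_bounded[OF compact] zero assms] by metis
  then show thesis using that radial_projection_eqI[of "d *\<^sub>R y" d y] by simp
qed

lemma continuous_on_radial_projection: "continuous_on (- {0}) (radial_projection K)"
proof -
  have sgn: "continuous_on (- {0}) (sgn :: 'a \<Rightarrow> 'a)"
    unfolding sgn_div_norm by (intro continuous_intros) auto
  have "continuous_on (frontier K) sgn"
    by (rule continuous_on_subset[OF sgn]) (use frontier_nonzero in auto)
  moreover have "compact (frontier K)" using compact by (rule compact_frontier)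
  ultimately have "continuous_on (sgn ` frontier K) (inv_into (frontier K) sgn)"
    by (rule continuous_on_inv) (simp add: inj_on_sgn_frontier)
  moreover have "sgn ` (- {0}) \<subseteq> sgn ` frontier K"
  proof (intro image_subsetI)
    fix y :: 'a assume "y \<in> - {0}"
    then obtain s where "0 < s" "s *\<^sub>R y \<in> frontier K" using radial_projection_ray by auto
    moreover from this have "sgn y = sgn (s *\<^sub>R y)" by (simp add: sgn_scaleR)
    ultimately show "sgn y \<in> sgn ` frontier K" by (metis imageI)
  qed
  ultimately show ?thesis
    unfolding radial_projection_def[abs_def] by (rule continuous_on_compose2[OF _ sgn])
qed

lemma measurable_radial_projection:
  "radial_projection K \<in> borel_measurable (restrict_space lborel (K - {0}))"
proof -
  have "radial_projection K \<in> borel_measurable (restrict_space borel (- {0}))"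
    by (intro borel_measurable_continuous_on_restrict continuous_on_radial_projection)
  then have "radial_projection K \<in> borel_measurable (restrict_space borel (K - {0}))"
    by (rule measurable_restrict_mono) auto
  moreover have "sets (restrict_space lborel (K - {0})) = sets (restrict_space borel (K - {0}))"
    by (intro sets_restrict_space_cong) simp
  ultimately show ?thesis using measurable_cong_sets by blast
qed

end

text \<open>\<open>cone_measure K A\<close> is the volume of the union of the segments from the origin to the
  points of \<open>A \<inter> frontier K\<close>.\<close>

definition cone_measure :: "'a::euclidean_space set \<Rightarrow> 'a measure" where
  "cone_measure K = distr (restrict_space lborel (K - {0})) borel (radial_projection K)"

lemma sets_cone_measure [simp]: "sets (cone_measure K) = sets borel"
  by (simp add: cone_measure_def)

lemma emeasure_cone_measure:
  assumes "compact K" "convex K" "0 \<in> interior K" "A \<in> sets borel"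
  shows "emeasure (cone_measure K) A = emeasure lborel {y \<in> K - {0}. radial_projection K y \<in> A}"
    and "{y \<in> K - {0}. radial_projection K y \<in> A} \<in> sets borel"
proof -
  have K: "K - {0} \<in> sets borel" using assms(1) by (auto simp: borel_compact)
  have eq: "radial_projection K -` A \<inter> space (restrict_space lborel (K - {0})) =
      {y \<in> K - {0}. radial_projection K y \<in> A}"
    by (auto simp: space_restrict_space)
  have m: "radial_projection K \<in> borel_measurable (restrict_space lborel (K - {0}))"
    using assms by (intro measurable_radial_projection)
  show "emeasure (cone_measure K) A = emeasure lborel {y \<in> K - {0}. radial_projection K y \<in> A}"
    unfolding cone_measure_def emeasure_distr[OF m assms(4)] eq
    using K by (intro emeasure_restrict_space) auto
  have "{y \<in> K - {0}. radial_projection K y \<in> A} \<in> sets (restrict_space lborel (K - {0}))"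
    using measurable_sets[OF m assms(4)] eq by simp
  then show "{y \<in> K - {0}. radial_projection K y \<in> A} \<in> sets borel"
    using K by (simp add: sets_restrict_space_iff)
qed

lemma emeasure_cone_measure_le:
  assumes "compact K" "convex K" "0 \<in> interior K" "A \<in> sets borel"
  shows "emeasure (cone_measure K) A \<le> emeasure lborel K"
  unfolding emeasure_cone_measure(1)[OF assms]
  using assms(1) by (intro emeasure_mono) (auto simp: borel_compact)

lemma finite_measure_cone_measure:
  assumes "compact K" "convex K" "0 \<in> interior K"
  shows "finite_measure (cone_measure K)"
proof
  have "emeasure (cone_measure K) UNIV \<le> emeasure lborel K"
    using assms by (intro emeasure_cone_measure_le) auto
  also have "\<dots> < \<infinity>" by (rule emeasure_compact_finite[OF assms(1)])
  finally show "emeasure (cone_measure K) (space (cone_measure K)) \<noteq> \<infinity>"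
    by (simp add: cone_measure_def)
qed

text \<open>Near a smooth boundary point \<open>x\<close> the body contains almost all of the cone with apex 0
  over a small disk centred at \<open>x\<close> in the tangent hyperplane.\<close>

lemma cone_measure_cball_ge:
  fixes K :: "(real ^ 'n) set"
  assumes K: "compact K" "convex K" "0 \<in> interior K" and x: "x \<in> frontier K"
    and u: "is_outer_unit_normal K x u" and uniq: "\<And>v. is_outer_unit_normal K x v \<Longrightarrow> v = u"
    and \<theta>: "0 < \<theta>" "\<theta> < 1"
  shows "\<exists>\<rho>0>0. \<forall>\<rho>. 0 < \<rho> \<and> \<rho> < \<rho>0 \<longrightarrow>
    unit_ball_vol (real (CARD('n) - 1)) * (\<theta> * \<rho>) ^ (CARD('n) - 1) * (x \<bullet> u) * \<theta> ^ CARD('n) / CARD('n)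
      \<le> measure (cone_measure K) (cball x \<rho>)"
proof -
  define h where "h = x \<bullet> u"
  have h: "0 < h" unfolding h_def by (rule inner_outer_normal_pos[OF K(3) u])
  have xK: "x \<in> K" using frontier_subset_body[OF K] x by blast
  have u1: "norm u = 1" and supp: "\<And>y. y \<in> K \<Longrightarrow> y \<bullet> u \<le> h"
    using u by (auto simp: is_outer_unit_normal_def h_def inner_diff_left)
  \<comment> \<open>Chosen so that \<open>e * (norm x + 1) = 1 - \<theta>\<close>, which is the
    relative error allowed in the final distance estimate.\<close>
  define e where "e = (1 - \<theta>) / (norm x + 1)"
  have nx: "0 < norm x + 1" by (simp add: add_nonneg_pos)
  have e: "0 < e" "e * (norm x + 1) = 1 - \<theta>" using \<theta> nx by (simp_all add: e_def)
  have en: "e * norm x \<le> 1" "e \<le> 1 - \<theta>"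
  proof -
    have "0 \<le> e * norm x" using e(1) by simp
    moreover have "e * norm x + e = 1 - \<theta>" using e(2) by (simp add: distrib_left)
    ultimately show "e * norm x \<le> 1" "e \<le> 1 - \<theta>" using e(1) \<theta> by linarith+
  qed
  have "0 < e * h / (1 + e * norm x)" using e h by (simp add: add_pos_nonneg)
  then obtain d where d: "0 < d"
      "\<And>q. norm q < d \<Longrightarrow> q \<bullet> u \<le> - (e * h / (1 + e * norm x)) * norm q \<Longrightarrow> x + q \<in> K"
    using smooth_point_tangent_cone[OF K(2) compact_imp_closed[OF K(1)] xK uniq] by metis
  \<comment> \<open>A point \<open>x + z\<close> of the tangent hyperplane near \<open>x\<close>
    enters \<open>K\<close> after contraction by \<open>1 + e * norm z\<close>, because its
    displacement \<open>q\<close> from \<open>x\<close> then lies in the cone provided by the choice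
    of \<open>d\<close>.\<close>
  have near: "(x + z) /\<^sub>R (1 + e * norm z) \<in> K" if z: "z \<bullet> u = 0" "norm z < d / 2" for z
  proof -
    define \<mu> where "\<mu> = 1 + e * norm z"
    have \<mu>: "1 \<le> \<mu>" using e(1) by (simp add: \<mu>_def)
    define q where "q = (z - (e * norm z) *\<^sub>R x) /\<^sub>R \<mu>"
    have "norm (z - (e * norm z) *\<^sub>R x) \<le> norm z * (1 + e * norm x)"
      using norm_triangle_ineq4[of z "(e * norm z) *\<^sub>R x"] e(1) by (simp add: algebra_simps)
    then have q1: "norm q \<le> norm z * (1 + e * norm x) / \<mu>"
      using \<mu> by (simp add: q_def divide_inverse mult.commute mult_left_mono)
    also have "\<dots> \<le> norm z * (1 + e * norm x)"
    proof -
      have "0 \<le> norm z * (1 + e * norm x)" using e(1) by simp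
      from mult_left_mono[OF \<mu> this] show ?thesis using \<mu> by (simp add: divide_le_eq)
    qed
    also have "\<dots> \<le> norm z * 2" using en by (intro mult_left_mono) auto
    finally have "norm q < d" using z(2) by simp
    moreover have "q \<bullet> u \<le> - (e * h / (1 + e * norm x)) * norm q"
    proof -
      have pos: "0 < 1 + e * norm x" using e(1) by (simp add: add_pos_nonneg)
      have "(e * h / (1 + e * norm x)) * norm q \<le>
          (e * h / (1 + e * norm x)) * (norm z * (1 + e * norm x) / \<mu>)"
        using q1 e h pos by (intro mult_left_mono) auto
      also have "\<dots> = e * h * norm z / \<mu>" using pos by simp
      finally show ?thesis
        using z(1) by (simp add: q_def inner_diff_left h_def[symmetric] divide_inverse mult_ac)
    qed
    ultimately have "x + q \<in> K" by (rule d(2))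
    also have "x + q = (x + z) /\<^sub>R \<mu>"
    proof -
      have "\<mu> *\<^sub>R q = z - (e * norm z) *\<^sub>R x" using \<mu> by (simp add: q_def)
      moreover have "\<mu> *\<^sub>R x = x + (e * norm z) *\<^sub>R x"
        by (simp add: \<mu>_def scaleR_add_left)
      ultimately have "\<mu> *\<^sub>R (x + q) = x + z" by (simp add: scaleR_add_right)
      then have "inverse \<mu> *\<^sub>R (\<mu> *\<^sub>R (x + q)) = (x + z) /\<^sub>R \<mu>" by simp
      then show ?thesis using \<mu> by simp
    qed
    finally show ?thesis by (simp add: \<mu>_def)
  qed
  have "unit_ball_vol (real (CARD('n) - 1)) * (\<theta> * \<rho>) ^ (CARD('n) - 1) * (x \<bullet> u) * \<theta> ^ CARD('n) / CARD('n)
      \<le> measure (cone_measure K) (cball x \<rho>)" if \<rho>: "0 < \<rho>" "\<rho> < min 1 (d / 2)" for \<rho>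
  proof -
    interpret C: finite_measure "cone_measure K" using K by (rule finite_measure_cone_measure)
    let ?Q = "{y. 0 < y \<bullet> u \<and> y \<bullet> u \<le> \<theta> * (x \<bullet> u) \<and>
      dist y ((y \<bullet> u / (x \<bullet> u)) *\<^sub>R x) \<le> (y \<bullet> u / (x \<bullet> u)) * (\<theta> * \<rho>)}"
    have "?Q \<subseteq> {y \<in> K - {0}. radial_projection K y \<in> cball x \<rho>}"
    proof
      fix y assume "y \<in> ?Q"
      then have y: "0 < y \<bullet> u" "y \<bullet> u \<le> \<theta> * h"
          "dist y ((y \<bullet> u / h) *\<^sub>R x) \<le> (y \<bullet> u / h) * (\<theta> * \<rho>)"
        by (auto simp: h_def)
      \<comment> \<open>The point \<open>y\<close> is written as \<open>\<tau> *\<^sub>R w\<close>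
        with \<open>w = x + z\<close> in the tangent hyperplane at distance at most
        \<open>\<theta> * \<rho>\<close> from \<open>x\<close>.\<close>
      define \<tau> where "\<tau> = y \<bullet> u / h"
      have \<tau>: "0 < \<tau>" "\<tau> \<le> \<theta>" using y h by (simp_all add: \<tau>_def divide_le_eq)
      define w where "w = y /\<^sub>R \<tau>"
      define z where "z = w - x"
      have yw: "y = \<tau> *\<^sub>R w" and wz: "w = x + z" using \<tau> by (simp_all add: w_def z_def)
      have "w \<bullet> u = h" using y(1) h by (simp add: w_def \<tau>_def)
      then have zu: "z \<bullet> u = 0" by (simp add: z_def inner_diff_left h_def)
      have "y - \<tau> *\<^sub>R x = \<tau> *\<^sub>R z" by (simp add: yw z_def algebra_simps)
      then have "\<tau> * norm z \<le> \<tau> * (\<theta> * \<rho>)"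
        using y(3) \<tau> by (simp add: \<tau>_def[symmetric] dist_norm)
      then have z: "norm z \<le> \<theta> * \<rho>" using \<tau> by simp
      have "\<theta> * \<rho> \<le> \<rho>" using \<theta> \<rho> by simp
      with z have "norm z \<le> \<rho>" by linarith
      then have z1: "norm z < d / 2" "norm z < 1" using \<rho> by auto
      define \<mu> where "\<mu> = 1 + e * norm z"
      have \<mu>: "1 \<le> \<mu>" using e(1) by (simp add: \<mu>_def)
      have \<mu>2: "\<mu> \<le> 1 + (1 - \<theta>)"
      proof -
        have "e * norm z \<le> e * 1" using e z1 by (intro mult_left_mono) auto
        then show ?thesis using en by (simp add: \<mu>_def)
      qed
      \<comment> \<open>This inequality is used twice: it puts \<open>y\<close> into
        \<open>K\<close>, and it keeps the projection of \<open>y\<close> within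
        \<open>\<rho>\<close> of \<open>x\<close>.\<close>
      have \<theta>2: "\<theta> * (1 + (1 - \<theta>)) \<le> 1"
      proof -
        have "0 \<le> (1 - \<theta>)\<^sup>2" by simp
        then show ?thesis by (simp add: power2_eq_square algebra_simps)
      qed
      have wK: "w /\<^sub>R \<mu> \<in> K" using near[OF zu z1(1)] by (simp add: wz \<mu>_def)
      have "\<tau> * \<mu> \<le> \<theta> * (1 + (1 - \<theta>))" using \<tau> \<mu> \<mu>2 \<theta> by (intro mult_mono) auto
      with \<theta>2 have \<tau>\<mu>: "\<tau> * \<mu> \<le> 1" by linarith
      have y_eq: "y = (\<tau> * \<mu>) *\<^sub>R (w /\<^sub>R \<mu>)" using \<mu> by (simp add: yw)
      have "y \<in> K"
      proof (cases "\<tau> * \<mu> = 1")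
        case True
        then show ?thesis using wK y_eq by simp
      next
        case False
        then have "(\<tau> * \<mu>) *\<^sub>R (w /\<^sub>R \<mu>) \<in> interior K"
          using \<tau>\<mu> \<tau> \<mu> wK by (intro scaleR_mem_interior[OF K]) auto
        then show ?thesis using y_eq interior_subset by blast
      qed
      moreover have "y \<noteq> 0" using y(1) by auto
      moreover have "radial_projection K y \<in> cball x \<rho>"
      proof -
        obtain s' where s': "0 < s'" "radial_projection K y = s' *\<^sub>R y" "s' *\<^sub>R y \<in> frontier K"
          using radial_projection_ray[OF K \<open>y \<noteq> 0\<close>] by blast
        define s where "s = s' * \<tau>"
        have s: "0 < s" "radial_projection K y = s *\<^sub>R w" "s *\<^sub>R w \<in> frontier K"
          using s' \<tau> by (simp_all add: s_def yw)
        \<comment> \<open>The projection \<open>s *\<^sub>R w\<close> satisfies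
          \<open>1 / \<mu> \<le> s \<le> 1\<close>: the supporting hyperplane gives the upper bound,
          the point \<open>w /\<^sub>R \<mu>\<close> of \<open>K\<close> the lower one.\<close>
        have "s * h \<le> 1 * h"
          using supp[of "s *\<^sub>R w"] s(3) frontier_subset_body[OF K] \<open>w \<bullet> u = h\<close> by auto
        then have s1: "s \<le> 1" using h by simp
        have "1 \<le> s * \<mu>"
        proof (rule ccontr)
          assume "\<not> 1 \<le> s * \<mu>"
          then have "(s * \<mu>) *\<^sub>R (w /\<^sub>R \<mu>) \<in> interior K"
            using s \<mu> wK by (intro scaleR_mem_interior[OF K]) auto
          moreover have "(s * \<mu>) *\<^sub>R (w /\<^sub>R \<mu>) = s *\<^sub>R w" using \<mu> by simp
          ultimately show False using s(3) by (auto simp only: frontier_def)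
        qed
        then have "1 - s \<le> s * (e * norm z)" by (simp add: \<mu>_def algebra_simps)
        also have "\<dots> \<le> 1 * (e * norm z)" using s1 e(1) by (intro mult_right_mono) auto
        finally have s2: "1 - s \<le> e * norm z" by simp
        have "x - s *\<^sub>R w = (1 - s) *\<^sub>R w - z" by (simp add: wz algebra_simps)
        then have "dist x (s *\<^sub>R w) \<le> (1 - s) * norm w + norm z"
          using norm_triangle_ineq4[of "(1 - s) *\<^sub>R w" z] s1 by (simp add: dist_norm)
        also have "\<dots> \<le> (e * norm z) * (norm x + 1) + norm z"
        proof -
          have "norm w \<le> norm x + 1" using norm_triangle_ineq[of x z] z1 by (simp add: wz)
          then show ?thesis using s2 s1 e(1) by (intro add_right_mono mult_mono) auto
        qed
        also have "\<dots> = norm z * (e * (norm x + 1) + 1)" by (simp add: algebra_simps)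
        also have "\<dots> = norm z * (1 + (1 - \<theta>))" unfolding e(2) by simp
        also have "\<dots> \<le> (\<theta> * \<rho>) * (1 + (1 - \<theta>))" using z \<theta> by (intro mult_right_mono) auto
        also have "\<dots> = \<rho> * (\<theta> * (1 + (1 - \<theta>)))" by simp
        also have "\<dots> \<le> \<rho> * 1" using \<theta>2 \<rho> by (intro mult_left_mono) auto
        finally show ?thesis by (simp add: s(2))
      qed
      ultimately show "y \<in> {y \<in> K - {0}. radial_projection K y \<in> cball x \<rho>}" by simp
    qed
    then have "emeasure lborel ?Q \<le> emeasure (cone_measure K) (cball x \<rho>)"
      unfolding emeasure_cone_measure(1)[OF K borel_closed[OF closed_cball]]
      using emeasure_cone_measure(2)[OF K borel_closed[OF closed_cball]]
      by (intro emeasure_mono) auto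
    also have "emeasure lborel ?Q = ennreal (unit_ball_vol (real (CARD('n) - 1)) *
        (\<theta> * \<rho>) ^ (CARD('n) - 1) * (x \<bullet> u) * \<theta> ^ CARD('n) / CARD('n))"
      using u1 h \<theta> \<rho> unfolding h_def by (intro emeasure_oblique_cone) auto
    finally show ?thesis by (simp add: C.emeasure_eq_measure)
  qed
  moreover have "0 < min 1 (d / 2)" using d(1) by simp
  ultimately show ?thesis by blast
qed

subsection \<open>Affine surface area\<close>

lemma sets_hausdorff_measure [simp]: "sets (hausdorff_measure k :: 'a::metric_space measure) = sets borel"
  by (simp add: hausdorff_measure_def sets_measure_of_conv sets.sigma_sets_eq[of borel, simplified])

lemma space_hausdorff_measure [simp]: "space (hausdorff_measure k) = UNIV"
  by (simp add: hausdorff_measure_def space_measure_of_conv)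

text \<open>At points of \<open>B\<close> the cone measure of a small ball is at least
  \<open>\<theta> ^ (k + CARD('n)) * c / CARD('n)\<close> times the volume
  \<open>w * \<rho> ^ k\<close> of a flat disk. The density bound for Hausdorff measure applies, and
  \<open>\<theta>\<close> tends to 1.\<close>

lemma hausdorff_measure_le_cone_measure:
  fixes K :: "(real ^ 'n) set"
  assumes n2: "2 \<le> CARD('n)" and K: "compact K" "convex K" "0 \<in> interior K"
    and B: "B \<in> sets borel" "B \<subseteq> frontier K"
    and uniq: "\<And>x. x \<in> B \<Longrightarrow> \<exists>!u. is_outer_unit_normal K x u"
    and c: "0 < c" "\<And>x. x \<in> B \<Longrightarrow> c \<le> x \<bullet> outer_normal K x"
  shows "ennreal c * emeasure (hausdorff_measure (CARD('n) - 1)) B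
    \<le> ennreal (real CARD('n)) * emeasure (cone_measure K) B"
proof -
  interpret C: finite_measure "cone_measure K" using K by (rule finite_measure_cone_measure)
  define k where "k = CARD('n) - 1"
  define m where "m = measure (cone_measure K) B"
  define w where "w = unit_ball_vol (real k)"
  let ?H = "emeasure (hausdorff_measure k) B"
  have k: "0 < k" using n2 by (simp add: k_def)
  have w: "0 < w" by (simp add: w_def)
  have le: "?H \<le> ennreal (real CARD('n) / (\<theta> ^ (k + CARD('n)) * c) * m)"
    if \<theta>: "0 < \<theta>" "\<theta> < 1" for \<theta>
  proof -
    define c' where "c' = w * \<theta> ^ k * c * \<theta> ^ CARD('n) / CARD('n)"
    have c': "0 < c'" using w \<theta> c by (simp add: c'_def)
    have "?H \<le> hausdorff_outer k B" by (rule emeasure_hausdorff_measure_le)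
    also have "\<dots> \<le> ennreal (unit_ball_vol (real k) / c') * emeasure (cone_measure K) B"
    proof (rule hausdorff_outer_le_of_density[OF sets_cone_measure C.finite_measure_axioms k c' B(1)])
      fix x assume x: "x \<in> B"
      let ?u = "outer_normal K x"
      have u: "is_outer_unit_normal K x ?u" using is_outer_unit_normal_outer_normal uniq[OF x] .
      then have "\<And>v. is_outer_unit_normal K x v \<Longrightarrow> v = ?u" using uniq[OF x] by blast
      from cone_measure_cball_ge[OF K subsetD[OF B(2) x] u this \<theta>]
      obtain \<rho>0 where \<rho>0: "0 < \<rho>0" "\<And>\<rho>. 0 < \<rho> \<Longrightarrow> \<rho> < \<rho>0 \<Longrightarrow>
        w * (\<theta> * \<rho>) ^ k * (x \<bullet> ?u) * \<theta> ^ CARD('n) / CARD('n) \<le> measure (cone_measure K) (cball x \<rho>)"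
        unfolding k_def w_def by blast
      have "c' * \<rho> ^ k \<le> measure (cone_measure K) (cball x \<rho>)" if \<rho>: "0 < \<rho>" "\<rho> < \<rho>0" for \<rho>
      proof -
        have "c' * \<rho> ^ k = w * (\<theta> * \<rho>) ^ k * c * \<theta> ^ CARD('n) / CARD('n)"
          by (simp add: c'_def power_mult_distrib)
        also have "\<dots> \<le> w * (\<theta> * \<rho>) ^ k * (x \<bullet> ?u) * \<theta> ^ CARD('n) / CARD('n)"
          using c(2)[OF x] w \<theta> \<rho>
          by (intro divide_right_mono mult_right_mono mult_left_mono) auto
        finally show ?thesis using \<rho>0(2)[OF \<rho>] by linarith
      qed
      then show "\<exists>\<rho>0>0. \<forall>\<rho>. 0 < \<rho> \<and> \<rho> < \<rho>0 \<longrightarrow> c' * \<rho> ^ k \<le> measure (cone_measure K) (cball x \<rho>)"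
        using \<rho>0(1) by blast
    qed
    also have "\<dots> = ennreal (w / c' * m)"
      unfolding C.emeasure_eq_measure w_def m_def by (rule ennreal_mult''[symmetric]) simp
    also have "w / c' = real CARD('n) / (\<theta> ^ (k + CARD('n)) * c)"
      using w \<theta> c by (simp add: c'_def power_add field_simps)
    finally show ?thesis .
  qed
  have "?H \<noteq> top" using le[of "1/2"] by (auto simp: top_unique)
  then obtain r where r: "0 \<le> r" "?H = ennreal r" by (cases ?H) auto
  have bound: "\<theta> ^ (k + CARD('n)) * (c * r) \<le> real CARD('n) * m" if \<theta>: "0 < \<theta>" "\<theta> < 1" for \<theta>
  proof -
    have "0 \<le> m" by (simp add: m_def)
    then have "r \<le> real CARD('n) / (\<theta> ^ (k + CARD('n)) * c) * m"
      using le[OF \<theta>] r \<theta> c by simp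
    then show ?thesis using \<theta> c by (simp add: field_simps)
  qed
  have "1 ^ (k + CARD('n)) * (c * r) \<le> real CARD('n) * m"
  proof (rule tendsto_upperbound)
    show "((\<lambda>\<theta>. \<theta> ^ (k + CARD('n)) * (c * r)) \<longlongrightarrow> 1 ^ (k + CARD('n)) * (c * r)) (at_left 1)"
      by (intro tendsto_intros)
    have "\<forall>\<^sub>F \<theta> in at_left 1. \<theta> \<in> {0 <..< 1 :: real}"
      by (rule eventually_at_leftI[of 0]) auto
    then show "\<forall>\<^sub>F \<theta> in at_left 1. \<theta> ^ (k + CARD('n)) * (c * r) \<le> real CARD('n) * m"
      by eventually_elim (use bound in auto)
  qed simp
  then have "ennreal (c * r) \<le> ennreal (real CARD('n) * m)" by (intro ennreal_leI) simp
  then show ?thesis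
    unfolding k_def[symmetric] C.emeasure_eq_measure r(2) m_def[symmetric]
    using c(1) r(1) by (simp add: ennreal_mult' ennreal_mult'')
qed

text \<open>Equality holds, but the reverse inequality would need the isodiametric inequality.\<close>

lemma nn_integral_support_function_le:
  fixes K :: "(real ^ 'n) set"
  assumes n2: "2 \<le> CARD('n)" and K: "compact K" "convex K" "0 \<in> interior K"
    and D: "D \<in> sets borel" "D \<subseteq> frontier K"
    and uniq: "\<And>x. x \<in> D \<Longrightarrow> \<exists>!u. is_outer_unit_normal K x u"
  shows "(\<integral>\<^sup>+x. ennreal (x \<bullet> outer_normal K x) * indicator D x \<partial>hausdorff_measure (CARD('n) - 1))
    \<le> ennreal (real CARD('n)) * emeasure lborel K"
proof -
  let ?M = "hausdorff_measure (CARD('n) - 1) :: (real ^ 'n) measure"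
  let ?f = "\<lambda>x. ennreal (x \<bullet> outer_normal K x) * indicator D x"
  show ?thesis
    unfolding nn_integral_def
  proof (rule SUP_least)
    \<comment> \<open>The integral is the supremum over simple functions below the integrand. The
      preceding lemma applies to each level set of positive value, and the cone measures of these
      disjoint sets add up to at most the volume of \<open>K\<close>.\<close>
    fix g assume "g \<in> {g. simple_function ?M g \<and> g \<le> ?f}"
    then have g: "simple_function ?M g" "\<And>x. g x \<le> ?f x" by (auto simp: le_fun_def)
    have fin: "finite (range g)" using simple_functionD(1)[OF g(1)] by simp
    have meas: "g -` {y} \<in> sets borel" for y using simple_functionD(2)[OF g(1), of "{y}"] by simp
    have "integral\<^sup>S ?M g = (\<Sum>y\<in>range g. y * emeasure ?M (g -` {y}))"
      by (simp add: simple_integral_def)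
    \<comment> \<open>The value 0 is dropped because its level set may leave
      \<open>D\<close>.\<close>
    also have "\<dots> = (\<Sum>y\<in>range g - {0}. y * emeasure ?M (g -` {y}))"
      using fin by (intro sum.mono_neutral_right) auto
    also have "\<dots> \<le> (\<Sum>y\<in>range g - {0}. ennreal (real CARD('n)) * emeasure (cone_measure K) (g -` {y}))"
    proof (rule sum_mono)
      fix y assume y: "y \<in> range g - {0}"
      then obtain x where "y = g x" by auto
      moreover have "?f x \<noteq> top" by (simp add: indicator_def)
      ultimately have "y \<noteq> top" using g(2)[of x] by (metis top_unique)
      then obtain c where c: "y = ennreal c" "0 < c"
        using y by (cases y) (auto simp: less_eq_real_def)
      have sub: "x \<in> D \<and> c \<le> x \<bullet> outer_normal K x" if "x \<in> g -` {y}" for x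
      proof -
        have le: "ennreal c \<le> ?f x" using g(2)[of x] that c by simp
        have "x \<in> D" by (rule ccontr) (use le c(2) in simp)
        then show ?thesis using le c(2) by (simp add: ennreal_le_iff2)
      qed
      show "y * emeasure ?M (g -` {y}) \<le> ennreal (real CARD('n)) * emeasure (cone_measure K) (g -` {y})"
        unfolding c(1)
      proof (rule hausdorff_measure_le_cone_measure[OF n2 K meas _ _ c(2)])
        show "g -` {ennreal c} \<subseteq> frontier K" using sub D(2) c(1) by blast
        fix x assume "x \<in> g -` {ennreal c}"
        then have "x \<in> g -` {y}" using c(1) by simp
        then show "\<exists>!u. is_outer_unit_normal K x u" "c \<le> x \<bullet> outer_normal K x"
          using sub uniq by blast+
      qed
    qed
    also have "\<dots> = ennreal (real CARD('n)) *
        (\<Sum>y\<in>range g - {0}. emeasure (cone_measure K) (g -` {y}))"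
      by (simp add: sum_distrib_left)
    also have "(\<Sum>y\<in>range g - {0}. emeasure (cone_measure K) (g -` {y})) =
        emeasure (cone_measure K) (\<Union>y\<in>range g - {0}. g -` {y})"
      using meas fin by (intro sum_emeasure) (auto simp: disjoint_family_on_def)
    also have "\<dots> \<le> emeasure lborel K"
      using meas fin by (intro emeasure_cone_measure_le[OF K] sets.finite_UN) auto
    finally show "integral\<^sup>S ?M g \<le> ennreal (real CARD('n)) * emeasure lborel K"
      by (simp add: mult_left_mono)
  qed
qed

text \<open>As \<open>gauss_curvature\<close> defaults to 0, every point of this set has a
  generalized Hessian and hence a unique normal.\<close>

definition positive_curvature_part :: "(real ^ 'n) set \<Rightarrow> (real ^ 'n) set" where
  "positive_curvature_part K = {x \<in> frontier K. gauss_curvature K x \<noteq> 0}"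

text \<open>Real-valued counterpart of the integrand in \<open>affine_surface_area\<close>; the two
  agree where curvature and support function are positive, since \<open>epowr\<close> is
  \<open>powr\<close> there.\<close>

definition affine_density :: "real \<Rightarrow> (real ^ 'n) set \<Rightarrow> real ^ 'n \<Rightarrow> real" where
  "affine_density p K x = (let n = real CARD('n) in
    gauss_curvature K x powr (p / (n + p)) / (x \<bullet> outer_normal K x) powr (n * (p - 1) / (n + p)))"

context
  fixes K :: "(real ^ 'n) set"
  assumes K: "convex_body K" "0 \<in> interior K"
    and null: "{x \<in> frontier K. gauss_curvature K x = 0} \<in> null_sets (surface_measure K)"
begin

lemma body: "compact K" "convex K" "closed K" "frontier K \<subseteq> K"
  using K(1) compact_imp_closed frontier_subset_closed by (auto simp: convex_body_def)

lemma positive_curvature_part_unique_normal: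
  "x \<in> positive_curvature_part K \<Longrightarrow> \<exists>!u. is_outer_unit_normal K x u"
  by (auto simp: positive_curvature_part_def gauss_curvature_def has_generalized_hessian_def
      split: if_splits)

lemma positive_curvature_part_pos:
  assumes "x \<in> positive_curvature_part K"
  shows "0 < gauss_curvature K x" "0 < x \<bullet> outer_normal K x"
  using assms body gauss_curvature_pos[of K x] inner_outer_normal_pos[OF K(2)]
    is_outer_unit_normal_outer_normal[OF positive_curvature_part_unique_normal[OF assms]]
  by (auto simp: positive_curvature_part_def)

lemma sets_surface_measure_iff:
  "A \<in> sets (surface_measure K) \<longleftrightarrow> A \<in> sets borel \<and> A \<subseteq> frontier K"
  unfolding surface_measure_def by (subst sets_restrict_space_iff) auto

text \<open>Members of \<open>null_sets\<close> are measurable sets, so the hypothesis on zero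
  curvature also supplies this.\<close>

lemma positive_curvature_part_borel: "positive_curvature_part K \<in> sets borel"
proof -
  have "{x \<in> frontier K. gauss_curvature K x = 0} \<in> sets borel"
    using null sets_surface_measure_iff by blast
  then have "frontier K - {x \<in> frontier K. gauss_curvature K x = 0} \<in> sets borel" by auto
  also have "frontier K - {x \<in> frontier K. gauss_curvature K x = 0} = positive_curvature_part K"
    by (auto simp: positive_curvature_part_def)
  finally show ?thesis .
qed

lemma AE_positive_curvature_part: "AE x in surface_measure K. x \<in> positive_curvature_part K"
proof -
  have "x \<in> frontier K" if "x \<in> space (surface_measure K)" for x
    using that by (simp add: surface_measure_def space_restrict_space)
  then show ?thesis
    by (intro AE_I'[OF null]) (auto simp: positive_curvature_part_def)
qed

lemma measurable_surface_measureI: "f \<in> borel_measurable borel \<Longrightarrow> f \<in> borel_measurable (surface_measure K)"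
  unfolding surface_measure_def
  by (intro measurable_restrict_space1) (simp cong: measurable_cong_sets)

lemma measurable_affine_density:
  "(\<lambda>x. ennreal (affine_density p K x) * indicator (positive_curvature_part K) x)
    \<in> borel_measurable (surface_measure K)"
proof (rule measurable_surface_measureI)
  let ?R = "restrict_space borel (positive_curvature_part K)"
  have [measurable]: "outer_normal K \<in> borel_measurable ?R"
    by (intro borel_measurable_outer_normal positive_curvature_part_unique_normal)
  have [measurable]: "gauss_curvature K \<in> borel_measurable ?R"
    by (rule borel_measurable_gauss_curvature[OF body(1)])
      (use body(4) in \<open>auto simp: positive_curvature_part_def gauss_curvature_def split: if_splits\<close>)
  have [measurable]: "(\<lambda>x. x) \<in> borel_measurable ?R" by (intro measurable_restrict_space1) simp
  have "(\<lambda>x. ennreal (affine_density p K x)) \<in> borel_measurable ?R"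
    unfolding affine_density_def Let_def by measurable
  then show "(\<lambda>x. ennreal (affine_density p K x) * indicator (positive_curvature_part K) x)
      \<in> borel_measurable borel"
    using positive_curvature_part_borel by (subst borel_measurable_restrict_space_iff_ennreal[symmetric]) auto
qed

text \<open>Replacing the integrand by 0 on a null set yields a measurable function, to which
  Hoelder's inequality applies.\<close>

lemma affine_surface_area_eq:
  "affine_surface_area p K =
    (\<integral>\<^sup>+x. ennreal (affine_density p K x) * indicator (positive_curvature_part K) x \<partial>surface_measure K)"
  unfolding affine_surface_area_def Let_def
proof (rule nn_integral_cong_AE, rule AE_mp[OF AE_positive_curvature_part], rule AE_I2, rule impI)
  fix x assume x: "x \<in> positive_curvature_part K"
  note pos = positive_curvature_part_pos[OF x]
  show "epowr (ennreal (gauss_curvature K x)) (p / (real CARD('n) + p)) /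
      epowr (ennreal (x \<bullet> outer_normal K x)) (real CARD('n) * (p - 1) / (real CARD('n) + p)) =
    ennreal (affine_density p K x) * indicator (positive_curvature_part K) x"
    using x pos by (simp add: epowr_ennreal divide_ennreal affine_density_def Let_def)
qed

lemma affine_surface_area_interpolation:
  fixes n p q t a b :: real
  assumes n: "n = real CARD('n)" and ne: "n + p \<noteq> 0" "n + q \<noteq> 0" "n + t \<noteq> 0"
    and ab: "0 < a" "0 < b" "a + b = 1"
    and p: "p / (n + p) = a * (t / (n + t)) + b * (q / (n + q))"
  shows "affine_surface_area p K \<le> epowr (affine_surface_area t K) a * epowr (affine_surface_area q K) b"
proof -
  let ?G = "\<lambda>p x. ennreal (affine_density p K x) * indicator (positive_curvature_part K) x"
  \<comment> \<open>The exponent of the support function is affine in \<open>v / (n + v)\<close>, so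
    with \<open>a + b = 1\<close> it inherits the convex combination assumed for
    \<open>p / (n + p)\<close>.\<close>
  have lin: "n * (v - 1) / (n + v) = (n + 1) * (v / (n + v)) - 1" if "n + v \<noteq> 0" for v
    using that by (simp add: field_simps)
  have p': "n * (p - 1) / (n + p) = a * (n * (t - 1) / (n + t)) + b * (n * (q - 1) / (n + q))"
    unfolding lin[OF ne(1)] lin[OF ne(2)] lin[OF ne(3)] p using ab(3) by (simp add: algebra_simps)
  have "?G p x = epowr (?G t x) a * epowr (?G q x) b" for x
  proof (cases "x \<in> positive_curvature_part K")
    case True
    note pos = positive_curvature_part_pos[OF True]
    have pos': "0 < affine_density v K x" for v using pos by (simp add: affine_density_def Let_def)
    have "affine_density p K x = affine_density t K x powr a * affine_density q K x powr b"
      using pos by (simp add: affine_density_def Let_def powr_divide powr_powr n[symmetric] p p'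
          powr_add mult.commute)
    then show ?thesis using True pos' by (simp add: epowr_ennreal ennreal_mult')
  qed (use ab in \<open>simp add: epowr_def\<close>)
  then show ?thesis
    unfolding affine_surface_area_eq
    using nn_integral_Hoelder_epowr[OF measurable_affine_density measurable_affine_density ab] by simp
qed

text \<open>For \<open>p = 0\<close> the exponents are 0 and -1: the curvature drops out and the
  density becomes \<open>x \<bullet> outer_normal K x\<close>.\<close>

lemma affine_surface_area_0_le:
  assumes "2 \<le> CARD('n)"
  shows "affine_surface_area 0 K \<le> ennreal (real CARD('n) * measure lebesgue K)"
proof -
  have "affine_surface_area 0 K =
    (\<integral>\<^sup>+x. ennreal (x \<bullet> outer_normal K x) * indicator (positive_curvature_part K) x \<partial>surface_measure K)"
    unfolding affine_surface_area_eq
  proof (rule nn_integral_cong)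
    fix x
    show "ennreal (affine_density 0 K x) * indicator (positive_curvature_part K) x =
        ennreal (x \<bullet> outer_normal K x) * indicator (positive_curvature_part K) x"
    proof (cases "x \<in> positive_curvature_part K")
      case True
      then show ?thesis using positive_curvature_part_pos[OF True]
        by (simp add: affine_density_def Let_def powr_minus_divide)
    qed simp
  qed
  also have "\<dots> = (\<integral>\<^sup>+x. ennreal (x \<bullet> outer_normal K x) * indicator (positive_curvature_part K) x *
      indicator (frontier K) x \<partial>hausdorff_measure (CARD('n) - 1))"
    unfolding surface_measure_def by (subst nn_integral_restrict_space) auto
  also have "\<dots> = (\<integral>\<^sup>+x. ennreal (x \<bullet> outer_normal K x) * indicator (positive_curvature_part K) x
      \<partial>hausdorff_measure (CARD('n) - 1))"
    by (intro nn_integral_cong) (auto simp: positive_curvature_part_def indicator_def)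
  also have "\<dots> \<le> ennreal (real CARD('n)) * emeasure lborel K"
    using assms body K(2) positive_curvature_part_borel positive_curvature_part_unique_normal
    by (intro nn_integral_support_function_le) (auto simp: positive_curvature_part_def)
  also have "emeasure lborel K = ennreal (measure lebesgue K)"
    using body(1) emeasure_compact_finite[OF body(1)]
    by (subst emeasure_eq_ennreal_measure) (auto simp: borel_compact)
  finally show ?thesis by (simp add: ennreal_mult)
qed

end

section \<open>Both inequalities from interpolation\<close>

theorem theorem4p1:
  fixes K :: "(real ^ 'n) set" and n r s t :: real
  assumes n_def: "n = real CARD('n)" and "n \<ge> 2"
    and "s \<noteq> - n" and "r \<noteq> - n" and "t \<noteq> - n"
    and "convex_body K" and "centroid K = 0"
    and "{x \<in> frontier K. gauss_curvature K x = 0} \<in> null_sets (surface_measure K)"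
  shows "(r \<noteq> s \<and> ((n + r) * (t - s)) / ((n + t) * (r - s)) > 1 \<longrightarrow>
            affine_surface_area r K \<le>
              epowr (affine_surface_area t K) (((r - s) * (n + t)) / ((t - s) * (n + r))) *
              epowr (affine_surface_area s K) (((t - r) * (n + s)) / ((t - s) * (n + r)))) \<and>
         (r \<noteq> 0 \<and> ((n + r) * t) / ((n + t) * r) > 1 \<longrightarrow>
            affine_surface_area r K / ennreal (n * measure lebesgue K) \<le>
              epowr (affine_surface_area t K / ennreal (n * measure lebesgue K))
                ((r * (n + t)) / (t * (n + r))))"
proof -
  note K = assms(6) centroid_in_interior[OF assms(6,7)] assms(8)
  \<comment> \<open>The second parameter \<open>q\<close> is kept general: it will be
    \<open>s\<close> in the first part and 0 in the second.\<close>
  have interpolation: "affine_surface_area r K \<le>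
        epowr (affine_surface_area t K) (((r - q) * (n + t)) / ((t - q) * (n + r))) *
        epowr (affine_surface_area q K) (((t - r) * (n + q)) / ((t - q) * (n + r)))"
    and exponents: "0 < ((r - q) * (n + t)) / ((t - q) * (n + r))"
      "0 < ((t - r) * (n + q)) / ((t - q) * (n + r))"
      "((r - q) * (n + t)) / ((t - q) * (n + r)) + ((t - r) * (n + q)) / ((t - q) * (n + r)) = 1"
    if q: "n + q \<noteq> 0" and c: "((n + r) * (t - q)) / ((n + t) * (r - q)) > 1" for q
  proof -
    let ?a = "((r - q) * (n + t)) / ((t - q) * (n + r))"
    let ?b = "((t - r) * (n + q)) / ((t - q) * (n + r))"
    have ne: "n + r \<noteq> 0" "n + t \<noteq> 0" using assms by auto
    \<comment> \<open>Division by zero yields 0, so a quotient above 1 has nonzero factors.\<close>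
    have tq: "t - q \<noteq> 0" "r - q \<noteq> 0" using c by auto
    \<comment> \<open>The exponent \<open>?a\<close> is the reciprocal of the quotient in the
      condition, so the condition says exactly that it lies strictly between 0 and 1.\<close>
    have "?a = inverse (((n + r) * (t - q)) / ((n + t) * (r - q)))" by (simp add: mult_ac)
    then show a: "0 < ?a" using c by (metis inverse_positive_iff_positive less_trans zero_less_one)
    have "?a < 1"
      using c \<open>?a = _\<close> by (metis inverse_less_1_iff)
    have "(r - q) * (n + t) + (t - r) * (n + q) = (t - q) * (n + r)" by (simp add: algebra_simps)
    then show ab: "?a + ?b = 1" using ne tq by (simp add: add_divide_distrib[symmetric])
    then show b: "0 < ?b" using \<open>?a < 1\<close> by linarith
    have "r / (n + r) = ?a * (t / (n + t)) + ?b * (q / (n + q))"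
      using ne tq q by (simp add: divide_simps) (simp add: algebra_simps)
    then show "affine_surface_area r K \<le> epowr (affine_surface_area t K) ?a * epowr (affine_surface_area q K) ?b"
      using ne q a b ab by (intro affine_surface_area_interpolation[OF K n_def])
  qed
  have "affine_surface_area r K / ennreal (n * measure lebesgue K) \<le>
      epowr (affine_surface_area t K / ennreal (n * measure lebesgue K)) ((r * (n + t)) / (t * (n + r)))"
    if c: "((n + r) * t) / ((n + t) * r) > 1"
  proof -
    define V where "V = n * measure lebesgue K"
    have V: "0 < V" using measure_convex_body_pos[OF K(1)] assms(2) by (simp add: V_def)
    let ?a = "(r * (n + t)) / (t * (n + r))" and ?b = "((t - r) * n) / (t * (n + r))"
    have ab: "0 < ?a" "0 < ?b" "?a + ?b = 1"
      using exponents[of 0] c assms(2) by simp_all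
    have "affine_surface_area r K \<le> epowr (affine_surface_area t K) ?a * epowr (affine_surface_area 0 K) ?b"
      using interpolation[of 0] c assms(2) by simp
    also have "\<dots> \<le> epowr (affine_surface_area t K) ?a * epowr (ennreal V) ?b"
      using affine_surface_area_0_le[OF K] assms(2) ab n_def
      by (intro mult_left_mono epowr_mono) (auto simp: V_def)
    finally have "affine_surface_area r K / ennreal V \<le>
        epowr (affine_surface_area t K) ?a * epowr (ennreal V) ?b / ennreal V"
      by (rule divide_right_mono_ennreal)
    also have "\<dots> = epowr (affine_surface_area t K) ?a * (ennreal (V powr ?b) / ennreal V)"
      using V by (simp add: epowr_ennreal ennreal_times_divide)
    also have "ennreal (V powr ?b) / ennreal V = ennreal (V powr ?b / V)"
      using V by (simp add: divide_ennreal)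
    \<comment> \<open>As the exponents add up to 1, dividing by \<open>V\<close> turns
      \<open>V powr ?b\<close> into the normalization \<open>1 / V powr ?a\<close> of the remaining
      factor.\<close>
    also have "V powr ?b / V = 1 / V powr ?a"
    proof -
      have "V powr ?b * V powr ?a = V powr 1" using ab(3) by (metis add.commute powr_add)
      then show ?thesis using V by (simp add: field_simps)
    qed
    also have "epowr (affine_surface_area t K) ?a * ennreal (1 / V powr ?a) =
        epowr (affine_surface_area t K) ?a / ennreal (V powr ?a)"
      using V by (simp add: ennreal_times_divide flip: divide_ennreal)
    also have "\<dots> = epowr (affine_surface_area t K / ennreal V) ?a"
      using ab V by (simp add: epowr_divide)
    finally show ?thesis by (simp add: V_def)
  qed
  then show ?thesis using interpolation[of s] assms(3) by auto
qed

end
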